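(* Let $M:R\to R$ be a co-rotating toral linked twist map with parameters $\alpha,\beta\in(0,1)$ and integers $k,\ell$ with $k\ell<0$, and set $\kappa=k\alpha^{-1}$, $\lambda=\ell\beta^{-1}$. If $\kappa\lambda<-4$, then the unstable manifold of $M$ has kinks.
   Context: Toral linked twist map (LTM). Let $\alpha,\beta\in(0,1)$, let $k,\ell$ be nonzero integers, $\kappa=k\alpha^{-1}$, $\lambda=\ell\beta^{-1}$. On the torus $\mathbb{R}^2/\mathbb{Z}^2$, with coordinates $x,y\in[0,1)$, define $R_V=\{0\le x\le\alpha,\ (y+\kappa x \bmod 1)\in(\beta,1)\}$, $R_H=\{\alpha<x<1,\ 0\le y\le\beta\}$, $R_L=\{0\le x\le\alpha,\ (y+\kappa x\bmod 1)\in[0,\beta]\}$, and $R=R_V\cup R_H\cup R_L$ (the union of the vertical strip $0\le x\le\alpha$ and the horizontal strip $0\le y\le\beta$). Let $V=\begin{bmatrix}1&0\\ \kappa&1\end{bmatrix}$, $H=\begin{bmatrix}1&\lambda\\0&1\end{bmatrix}$, $L=HV=\begin{bmatrix}1+\kappa\lambda&\lambda\\ \kappa&1\end{bmatrix}$. The toral LTM is the continuous, piecewise linear bijection $M:R\to R$ given (mod 1) by $M(z)=Vz$ on $R_V$, $M(z)=Hz$ on $R_H$, $M(z)=Lz$ on $R_L$. It is co-rotating if $k\ell<0$; the condition $\kappa\lambda<-4$ makes $L$ hyperbolic. Singular set. $\mathcal{S}\subset R$ consists of all points on the boundaries of $R_L,R_V,R_H$ together with all forward and backward images under $M$ of these points;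 it has measure zero. Unstable manifold (standard notion). A local unstable segment at $p$ is an open straight line segment $\gamma\ni p$ in $R$ such that every $M^{-n}$, $n\ge0$, is affine on $\gamma$ and the length of $M^{-n}(\gamma)$ tends to $0$ exponentially as $n\to\infty$. The (global) unstable manifold of a point $z\in R\setminus\mathcal{S}$ at which a local unstable segment exists is the union, over all $n\ge0$ and all local unstable segments $\gamma$ at $M^{-n}(z)$, of $M^n(\gamma)$. It is a piecewise straight curve which may have bends at points of $\mathcal{S}$ (by continuity, one also speaks of the unstable manifold at such points). "The unstable manifold of $M$" refers to all of these curves collectively. Kinks. A kink is a vertex at which the two adjacent straight pieces of the curve form an acute angle (the vectors emanating from the vertex along the two pieces make an angle less than $\pi/2$). The unstable manifold of $M$ has kinks if kinks occur in it, i.e. there exist unstable manifolds of points of $R\setminus\mathcal{S}$ containing a kink. *)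

theory Defs
  imports "HOL-Analysis.Analysis"
begin

text \<open>
  The torus is represented by the fundamental domain of pairs with both coordinates in
  the half-open unit interval; \<open>torus_proj\<close> is the quotient map from the plane.  Straight
  segments, lengths, angles and boundaries in the torus are expressed through lifts to the plane.
\<close>

definition torus_proj :: "real \<times> real \<Rightarrow> real \<times> real" where
  "torus_proj p = (frac (fst p), frac (snd p))"

definition unit_square :: "(real \<times> real) set" where
  "unit_square = {0..<1} \<times> {0..<1}"

text \<open>
  The boundary is taken in the quotient topology (the quotient map is open), so that the
  seams \<open>x = 0\<close> and \<open>y = 0\<close> of the fundamental domain do not count as boundary by themselves.
\<close>

definition torus_frontier :: "(real \<times> real) set \<Rightarrow> (real \<times> real) set" where
  "torus_frontier A = torus_proj ` frontier (torus_proj -` A)"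

definition R_V :: "real \<Rightarrow> real \<Rightarrow> real \<Rightarrow> (real \<times> real) set" where
  "R_V \<alpha> \<beta> \<kappa> = {(x, y) \<in> unit_square. x \<le> \<alpha> \<and> frac (y + \<kappa> * x) \<in> {\<beta><..<1}}"

definition R_H :: "real \<Rightarrow> real \<Rightarrow> (real \<times> real) set" where
  "R_H \<alpha> \<beta> = {(x, y) \<in> unit_square. \<alpha> < x \<and> y \<le> \<beta>}"

definition R_L :: "real \<Rightarrow> real \<Rightarrow> real \<Rightarrow> (real \<times> real) set" where
  "R_L \<alpha> \<beta> \<kappa> = {(x, y) \<in> unit_square. x \<le> \<alpha> \<and> frac (y + \<kappa> * x) \<in> {0..\<beta>}}"

definition ltm_domain :: "real \<Rightarrow> real \<Rightarrow> real \<Rightarrow> (real \<times> real) set" where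
  "ltm_domain \<alpha> \<beta> \<kappa> = R_V \<alpha> \<beta> \<kappa> \<union> R_H \<alpha> \<beta> \<union> R_L \<alpha> \<beta> \<kappa>"

definition V_map :: "real \<Rightarrow> real \<times> real \<Rightarrow> real \<times> real" where
  "V_map \<kappa> z = (fst z, \<kappa> * fst z + snd z)"

definition H_map :: "real \<Rightarrow> real \<times> real \<Rightarrow> real \<times> real" where
  "H_map lam z = (fst z + lam * snd z, snd z)"

text \<open>
  On \<open>R_L\<close> the matrix \<open>L = HV\<close> has to be applied with the intermediate point \<open>Vz\<close> reduced
  modulo 1: the coefficient \<open>lam\<close> is in general not an integer, so \<open>H\<close> descends to the torus
  only through the representative whose second coordinate lies in \<open>[0, \<beta>]\<close>.
  The value outside the domain is irrelevant.
\<close>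

definition ltm :: "real \<Rightarrow> real \<Rightarrow> real \<Rightarrow> real \<Rightarrow> real \<times> real \<Rightarrow> real \<times> real" where
  "ltm \<alpha> \<beta> \<kappa> lam z =
    (if z \<in> R_V \<alpha> \<beta> \<kappa> then torus_proj (V_map \<kappa> z)
     else if z \<in> R_H \<alpha> \<beta> then torus_proj (H_map lam z)
     else if z \<in> R_L \<alpha> \<beta> \<kappa> then torus_proj (H_map lam (torus_proj (V_map \<kappa> z)))
     else z)"

definition ltm_inv :: "real \<Rightarrow> real \<Rightarrow> real \<Rightarrow> real \<Rightarrow> real \<times> real \<Rightarrow> real \<times> real" where
  "ltm_inv \<alpha> \<beta> \<kappa> lam = inv_into (ltm_domain \<alpha> \<beta> \<kappa>) (ltm \<alpha> \<beta> \<kappa> lam)"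

definition ltm_boundary :: "real \<Rightarrow> real \<Rightarrow> real \<Rightarrow> (real \<times> real) set" where
  "ltm_boundary \<alpha> \<beta> \<kappa> =
    torus_frontier (R_L \<alpha> \<beta> \<kappa>) \<union> torus_frontier (R_V \<alpha> \<beta> \<kappa>) \<union> torus_frontier (R_H \<alpha> \<beta>)"

definition singular_set :: "real \<Rightarrow> real \<Rightarrow> real \<Rightarrow> real \<Rightarrow> (real \<times> real) set" where
  "singular_set \<alpha> \<beta> \<kappa> lam =
    (\<Union>n. (ltm \<alpha> \<beta> \<kappa> lam ^^ n) ` ltm_boundary \<alpha> \<beta> \<kappa>
         \<union> (ltm_inv \<alpha> \<beta> \<kappa> lam ^^ n) ` ltm_boundary \<alpha> \<beta> \<kappa>)"

text \<open>
  \<open>f\<close> is affine (modulo 1) on the projected open segment from \<open>a\<close> to \<open>b\<close>, and its image is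
  the projected open segment from \<open>a'\<close> to \<open>b'\<close>, traversed affinely.
  The length of that image in the torus is \<open>dist a' b'\<close>.
\<close>

definition maps_segment_affinely ::
  "(real \<times> real \<Rightarrow> real \<times> real) \<Rightarrow> real \<times> real \<Rightarrow> real \<times> real \<Rightarrow> real \<times> real \<Rightarrow> real \<times> real \<Rightarrow> bool"
where
  "maps_segment_affinely f a b a' b' \<longleftrightarrow>
    (\<forall>t\<in>{0<..<1}. f (torus_proj ((1 - t) *\<^sub>R a + t *\<^sub>R b)) =
                  torus_proj ((1 - t) *\<^sub>R a' + t *\<^sub>R b'))"

definition local_unstable_segment ::
  "real \<Rightarrow> real \<Rightarrow> real \<Rightarrow> real \<Rightarrow> real \<times> real \<Rightarrow> (real \<times> real) set \<Rightarrow> bool"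
where
  "local_unstable_segment \<alpha> \<beta> \<kappa> lam p \<gamma> \<longleftrightarrow>
    p \<in> \<gamma> \<and> \<gamma> \<subseteq> ltm_domain \<alpha> \<beta> \<kappa> \<and>
    (\<exists>a b. a \<noteq> b \<and> \<gamma> = torus_proj ` open_segment a b \<and>
      (\<exists>a' b' C r. 0 < r \<and> r < 1 \<and>
        (\<forall>n::nat. maps_segment_affinely (ltm_inv \<alpha> \<beta> \<kappa> lam ^^ n) a b (a' n) (b' n) \<and>
                  dist (a' n) (b' n) \<le> C * r ^ n)))"

definition unstable_arcs ::
  "real \<Rightarrow> real \<Rightarrow> real \<Rightarrow> real \<Rightarrow> real \<times> real \<Rightarrow> (real \<times> real) set set"
where
  "unstable_arcs \<alpha> \<beta> \<kappa> lam z =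
    {(ltm \<alpha> \<beta> \<kappa> lam ^^ n) ` \<gamma> | n \<gamma>.
       local_unstable_segment \<alpha> \<beta> \<kappa> lam ((ltm_inv \<alpha> \<beta> \<kappa> lam ^^ n) z) \<gamma>}"

definition unstable_manifold ::
  "real \<Rightarrow> real \<Rightarrow> real \<Rightarrow> real \<Rightarrow> real \<times> real \<Rightarrow> (real \<times> real) set"
where
  "unstable_manifold \<alpha> \<beta> \<kappa> lam z = \<Union> (unstable_arcs \<alpha> \<beta> \<kappa> lam z)"

definition vec_angle :: "real \<times> real \<Rightarrow> real \<times> real \<Rightarrow> real" where
  "vec_angle v w = arccos ((v \<bullet> w) / (norm v * norm w))"

text \<open>
  A curve is given by the family \<open>\<A>\<close> of simple arcs it is the union of.  Both straight pieces
  at the vertex are required to lie in one and the same arc: this makes them adjacent along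
  the curve, whereas the union as a set might contain unrelated pieces that merely meet.
  The angle \<open>0\<close> is excluded because it would describe one piece taken twice.
\<close>

definition kink_of :: "(real \<times> real) set set \<Rightarrow> real \<times> real \<Rightarrow> bool" where
  "kink_of \<A> q \<longleftrightarrow>
    (\<exists>A\<in>\<A>. \<exists>p v w. torus_proj p = q \<and> v \<noteq> 0 \<and> w \<noteq> 0 \<and>
       torus_proj ` closed_segment p (p + v) \<subseteq> A \<and>
       torus_proj ` closed_segment p (p + w) \<subseteq> A \<and>
       0 < vec_angle v w \<and> vec_angle v w < pi / 2)"

definition unstable_manifold_has_kinks :: "real \<Rightarrow> real \<Rightarrow> real \<Rightarrow> real \<Rightarrow> bool" where
  "unstable_manifold_has_kinks \<alpha> \<beta> \<kappa> lam \<longleftrightarrow>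
    (\<exists>z \<in> ltm_domain \<alpha> \<beta> \<kappa> - singular_set \<alpha> \<beta> \<kappa> lam.
       (\<exists>\<gamma>. local_unstable_segment \<alpha> \<beta> \<kappa> lam z \<gamma>) \<and>
       (\<exists>q \<in> unstable_manifold \<alpha> \<beta> \<kappa> lam z. kink_of (unstable_arcs \<alpha> \<beta> \<kappa> lam z) q))"

end

theory Submission
  imports Defs
begin

text \<open>
  Write the map as the composition of a vertical shear \<open>f\<close> and a horizontal shear \<open>g\<close>.  The centre
  \<open>(\<alpha>/2, \<beta>/2)\<close> of the two strips is periodic, because on the core line of its strip a shear is a
  rotation by a multiple of \<open>1/2\<close>; its orbit avoids the boundaries of the regions, and its derivative
  is \<open>H\<^sup>b V\<^sup>a\<close> with \<open>a, b \<in> {1, 2}\<close>, which is hyperbolic.  The segments through it along the expanding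
  eigendirection grow under iteration until one of them crosses an edge of a strip, where \<open>f\<close> or \<open>g\<close>
  bends it.  In the co-rotating case the two branches at such a bend are then carried by the next
  shear into one and the same quadrant, so that they make an acute angle.
\<close>

subsection \<open>The torus projection\<close>

text \<open>Acuteness depends on the slope at the crossing, so slopes are tracked. Let \<sigma> be
  the slope divided by \<kappa>. The shear \<open>f\<close> adds 1 to \<sigma>, and \<open>g\<close>
  replaces \<sigma> by \<sigma> / (1 + \<kappa> \<lambda> \<sigma>). Hence \<open>f\<close> takes
  \<sigma> > -1/2 to \<sigma> > 1/2, and because of \<kappa> \<lambda> < -4 \<open>g\<close> takes
  \<sigma> > 1/2 back to -1/2 < \<sigma> < 0. These bounds are also what makes the bends acute: -1/2
  < \<sigma> < 0 on arrival at an edge of the vertical strip, \<sigma> > 1/2 on arrival at an edge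
  of the horizontal one. A bend made by \<open>g\<close> becomes acute only after the next
  \<open>f\<close>, which is followed by a further \<open>g\<close> before the second iterate of the
  map is complete. Both branches then leave the vertex upwards, so this \<open>g\<close> is one
  linear map on both of them and keeps them in a common quadrant. The crossing is forced by
  contradiction: without kinks a segment through the centre would stay straight for every period and
  outgrow the strip.\<close>

lemma frac_eqI:
  fixes a b :: real
  assumes "a - b = of_int n"
  shows "frac a = frac b"
  using assms by (metis add.commute diff_add_cancel frac_add_of_int_right)

lemma frac_shift:
  fixes a :: real
  assumes "of_int n \<le> a" "a < of_int n + 1"
  shows "frac a = a - of_int n"
  using assms by (simp add: frac_unique_iff)

lemma torus_proj_eqI:
  assumes "a - a' = of_int m" "b - b' = of_int n"
  shows "torus_proj (a, b) = torus_proj (a', b')"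
  using assms frac_eqI unfolding torus_proj_def by (metis fst_conv snd_conv)

lemma fst_torus_proj [simp]: "fst (torus_proj p) = frac (fst p)"
  and snd_torus_proj [simp]: "snd (torus_proj p) = frac (snd p)"
  by (simp_all add: torus_proj_def)

lemma frac_cancel:
  fixes y y' c :: real
  assumes "frac (c + y) = frac (c + y')" "0 \<le> y" "y < 1" "0 \<le> y'" "y' < 1"
  shows "y = y'"
proof -
  have "frac y = frac y'"
    using assms(1) by (elim frac_eqE) (auto intro: frac_eqI)
  then show ?thesis using assms by simp
qed

subsection \<open>The map as a composition of two shears\<close>

text \<open>The equations for \<open>k\<close> and \<open>l\<close> make each shear an integer
  translation on the far edge of its strip, hence the identity there modulo 1.\<close>

locale twist =
  fixes \<alpha> \<beta> \<kappa> lam :: real and k l :: int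
  assumes \<alpha>: "0 < \<alpha>" "\<alpha> < 1" and \<beta>: "0 < \<beta>" "\<beta> < 1"
    and k: "\<kappa> * \<alpha> = of_int k" and l: "lam * \<beta> = of_int l"
    and hyp: "\<kappa> * lam < -4"
begin

abbreviation R where "R \<equiv> ltm_domain \<alpha> \<beta> \<kappa>"
abbreviation M where "M \<equiv> ltm \<alpha> \<beta> \<kappa> lam"
abbreviation Minv where "Minv \<equiv> ltm_inv \<alpha> \<beta> \<kappa> lam"

definition f where "f z = (if fst z \<le> \<alpha> then torus_proj (V_map \<kappa> z) else z)"
definition g where "g z = (if snd z \<le> \<beta> then torus_proj (H_map lam z) else z)"

lemma R_iff:
  "z \<in> R \<longleftrightarrow> 0 \<le> fst z \<and> fst z < 1 \<and> 0 \<le> snd z \<and> snd z < 1 \<and> (fst z \<le> \<alpha> \<or> snd z \<le> \<beta>)"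
proof -
  have "frac w \<le> \<beta> \<or> \<beta> < frac w \<and> frac w < 1" for w :: real
    using frac_lt_1[of w] by linarith
  then show ?thesis
    by (cases z) (auto simp: ltm_domain_def R_V_def R_H_def R_L_def unit_square_def)
qed

lemma torus_proj_R [simp]: "z \<in> R \<Longrightarrow> torus_proj z = z"
  by (simp add: R_iff torus_proj_def prod_eq_iff)

lemma torus_proj_in_R: "torus_proj z \<in> R \<longleftrightarrow> frac (fst z) \<le> \<alpha> \<or> frac (snd z) \<le> \<beta>"
  by (simp add: R_iff frac_lt_1)

text \<open>Any translate of the strip is allowed, so lifts need not be normalised. The edges belong
  both to this case and to \<open>f_outside\<close>, so that a branch can be followed from the edge
  into either side.\<close>

lemma f_strip:
  assumes "of_int m \<le> x" "x \<le> of_int m + \<alpha>"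
  shows "f (torus_proj (x, y)) = torus_proj (x, y + \<kappa> * (x - of_int m))"
proof -
  have *: "frac x = x - of_int m"
    using assms \<alpha> by (intro frac_shift) auto
  moreover have "frac x \<le> \<alpha>" using * assms by linarith
  ultimately show ?thesis by (simp add: f_def torus_proj_def V_map_def add.commute flip: *)
qed

lemma f_outside:
  assumes "of_int m + \<alpha> \<le> x" "x \<le> of_int m + 1"
  shows "f (torus_proj (x, y)) = torus_proj (x, y)"
proof (cases "x = of_int m + \<alpha>")
  case True
  then have "f (torus_proj (x, y)) = torus_proj (x, y + \<kappa> * (x - of_int m))"
    using \<alpha> by (intro f_strip) auto
  also have "\<dots> = torus_proj (x, y)"
    using True k by (intro torus_proj_eqI[where m = 0 and n = k]) (auto simp: algebra_simps)
  finally show ?thesis .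
next
  case False
  show ?thesis
  proof (cases "x = of_int m + 1")
    case True
    then show ?thesis using f_strip[of "m + 1" x y] \<alpha> by simp
  next
    case F: False
    then have "frac x = x - of_int m"
      using assms \<alpha> by (intro frac_shift) auto
    then show ?thesis using False assms by (simp add: f_def)
  qed
qed

lemma g_strip:
  assumes "of_int m \<le> y" "y \<le> of_int m + \<beta>"
  shows "g (torus_proj (x, y)) = torus_proj (x + lam * (y - of_int m), y)"
proof -
  have *: "frac y = y - of_int m"
    using assms \<beta> by (intro frac_shift) auto
  moreover have "frac y \<le> \<beta>" using * assms by linarith
  ultimately show ?thesis by (simp add: g_def torus_proj_def H_map_def flip: *)
qed

lemma g_outside:
  assumes "of_int m + \<beta> \<le> y" "y \<le> of_int m + 1"
  shows "g (torus_proj (x, y)) = torus_proj (x, y)"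
proof (cases "y = of_int m + \<beta>")
  case True
  then have "g (torus_proj (x, y)) = torus_proj (x + lam * (y - of_int m), y)"
    using \<beta> by (intro g_strip) auto
  also have "\<dots> = torus_proj (x, y)"
    using True l by (intro torus_proj_eqI[where m = l and n = 0]) (auto simp: algebra_simps)
  finally show ?thesis .
next
  case False
  show ?thesis
  proof (cases "y = of_int m + 1")
    case True
    then show ?thesis using g_strip[of "m + 1" y x] \<beta> by simp
  next
    case F: False
    then have "frac y = y - of_int m"
      using assms \<beta> by (intro frac_shift) auto
    then show ?thesis using False assms by (simp add: g_def)
  qed
qed

section \<open>Bijectivity of the map on \<open>R\<close>\<close>

lemma fst_f: "z \<in> R \<Longrightarrow> fst (f z) = fst z"
  by (simp add: f_def V_map_def R_iff)

lemma snd_g: "z \<in> R \<Longrightarrow> snd (g z) = snd z"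
  by (simp add: g_def H_map_def R_iff)

lemma f_R: "z \<in> R \<Longrightarrow> f z \<in> R"
  by (auto simp: f_def V_map_def torus_proj_in_R) (simp add: R_iff)

lemma g_R: "z \<in> R \<Longrightarrow> g z \<in> R"
  by (auto simp: g_def H_map_def torus_proj_in_R) (simp add: R_iff)

text \<open>On \<open>R_V\<close> the first shear leads out of the horizontal strip, where
  \<open>g\<close> is idle; on \<open>R_H\<close> it is \<open>f\<close> that is idle; on
  \<open>R_L\<close> both act.\<close>

lemma ltm_eq:
  assumes "z \<in> R"
  shows "M z = g (f z)"
proof -
  obtain x y where z: "z = (x, y)" by fastforce
  consider "z \<in> R_V \<alpha> \<beta> \<kappa>" | "z \<notin> R_V \<alpha> \<beta> \<kappa>" "z \<in> R_H \<alpha> \<beta>"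
    | "z \<notin> R_V \<alpha> \<beta> \<kappa>" "z \<notin> R_H \<alpha> \<beta>" "z \<in> R_L \<alpha> \<beta> \<kappa>"
    using assms by (auto simp: ltm_domain_def)
  then show ?thesis
  proof cases
    case 1
    then show ?thesis by (simp add: ltm_def R_V_def f_def g_def V_map_def z add.commute)
  next
    case 2
    then show ?thesis by (simp add: ltm_def R_H_def f_def g_def z)
  next
    case 3
    then show ?thesis by (simp add: ltm_def R_L_def f_def g_def V_map_def z add.commute)
  qed
qed

lemma ltm_R: "z \<in> R \<Longrightarrow> M z \<in> R"
  by (simp add: ltm_eq f_R g_R)

lemma inj_f: "inj_on f R"
proof (rule inj_onI)
  fix z z' assume *: "z \<in> R" "z' \<in> R" "f z = f z'"
  then have "fst z = fst z'" using fst_f by metis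
  moreover have "snd z = snd z'"
  proof (cases "fst z \<le> \<alpha>")
    case True
    then have "frac (\<kappa> * fst z + snd z) = frac (\<kappa> * fst z + snd z')"
      using \<open>fst z = fst z'\<close> *(3) by (simp add: f_def V_map_def torus_proj_def)
    then show ?thesis by (rule frac_cancel) (use * in \<open>auto simp: R_iff\<close>)
  next
    case False
    then show ?thesis using \<open>fst z = fst z'\<close> *(3) by (simp add: f_def)
  qed
  ultimately show "z = z'" by (simp add: prod_eq_iff)
qed

lemma inj_g: "inj_on g R"
proof (rule inj_onI)
  fix z z' assume *: "z \<in> R" "z' \<in> R" "g z = g z'"
  then have "snd z = snd z'" using snd_g by metis
  moreover have "fst z = fst z'"
  proof (cases "snd z \<le> \<beta>")
    case True
    then have "frac (lam * snd z + fst z) = frac (lam * snd z + fst z')"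
      using \<open>snd z = snd z'\<close> *(3) by (simp add: g_def H_map_def torus_proj_def add.commute)
    then show ?thesis by (rule frac_cancel) (use * in \<open>auto simp: R_iff\<close>)
  next
    case False
    then show ?thesis using \<open>snd z = snd z'\<close> *(3) by (simp add: g_def)
  qed
  ultimately show "z = z'" by (simp add: prod_eq_iff)
qed

lemma surj_f:
  assumes "z \<in> R"
  shows "\<exists>z'\<in>R. f z' = z"
proof (cases "fst z \<le> \<alpha>")
  case True
  let ?z' = "torus_proj (fst z, snd z - \<kappa> * fst z)"
  have "f ?z' = torus_proj (fst z, snd z - \<kappa> * fst z + \<kappa> * (fst z - of_int 0))"
    using True assms by (intro f_strip) (auto simp: R_iff)
  then have "f ?z' = z" using assms by simp
  moreover have "?z' \<in> R"
    using True assms unfolding torus_proj_in_R by (simp add: R_iff)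
  ultimately show ?thesis by blast
next
  case False
  then show ?thesis using assms by (intro bexI[of _ z]) (auto simp: f_def)
qed

lemma surj_g:
  assumes "z \<in> R"
  shows "\<exists>z'\<in>R. g z' = z"
proof (cases "snd z \<le> \<beta>")
  case True
  let ?z' = "torus_proj (fst z - lam * snd z, snd z)"
  have "g ?z' = torus_proj (fst z - lam * snd z + lam * (snd z - of_int 0), snd z)"
    using True assms by (intro g_strip) (auto simp: R_iff)
  then have "g ?z' = z" using assms by simp
  moreover have "?z' \<in> R"
    using True assms unfolding torus_proj_in_R by (simp add: R_iff)
  ultimately show ?thesis by blast
next
  case False
  then show ?thesis using assms by (intro bexI[of _ z]) (auto simp: g_def)
qed

lemma inj_ltm: "inj_on M R"
proof (rule inj_onI)
  fix z z' assume "z \<in> R" "z' \<in> R" "M z = M z'"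
  then show "z = z'"
    using inj_onD[OF inj_g, of "f z" "f z'"] inj_onD[OF inj_f, of z z'] by (simp add: ltm_eq f_R)
qed

lemma ltm_image: "M ` R = R"
proof
  show "M ` R \<subseteq> R" using ltm_R by blast
  show "R \<subseteq> M ` R"
  proof
    fix z assume "z \<in> R"
    then obtain z' z'' where "z' \<in> R" "g z' = z" "z'' \<in> R" "f z'' = z'"
      using surj_g surj_f by meson
    then have "M z'' = z" by (simp add: ltm_eq)
    then show "z \<in> M ` R" using \<open>z'' \<in> R\<close> by blast
  qed
qed

lemma ltm_inv_ltm: "z \<in> R \<Longrightarrow> Minv (M z) = z"
  by (simp add: ltm_inv_def inv_into_f_f inj_ltm)

lemma ltm_ltm_inv: "z \<in> R \<Longrightarrow> M (Minv z) = z"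
  by (simp add: ltm_inv_def f_inv_into_f ltm_image)

lemma ltm_inv_R: "z \<in> R \<Longrightarrow> Minv z \<in> R"
  unfolding ltm_inv_def by (rule inv_into_into) (simp add: ltm_image)

lemma ltm_pow_R: "z \<in> R \<Longrightarrow> (M ^^ n) z \<in> R"
  by (induction n) (auto intro: ltm_R)

lemma ltm_inv_pow_ltm_pow: "z \<in> R \<Longrightarrow> (Minv ^^ n) ((M ^^ n) z) = z"
  by (induction n) (simp_all add: funpow_swap1[of Minv] ltm_inv_ltm ltm_pow_R)

end

subsection \<open>The singular set\<close>

lemma not_frontierI:
  assumes "\<forall>\<^sub>F w in nhds P. (w \<in> S) = b"
  shows "P \<notin> frontier S"
proof -
  obtain U where U: "open U" "P \<in> U" "\<forall>w\<in>U. (w \<in> S) = b"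
    using assms by (auto simp: eventually_nhds)
  then have "P \<in> interior S \<or> P \<in> interior (- S)"
    by (cases b) (auto intro: interiorI)
  then show ?thesis by (auto simp: frontier_interiors)
qed

lemma isCont_frac_comp:
  fixes h :: "'a::t2_space \<Rightarrow> real"
  assumes "isCont h P" "frac (h P) \<noteq> 0"
  shows "isCont (\<lambda>w. frac (h w)) P"
  using assms continuous_frac by (intro continuous_within_compose3[where f = h and g = frac]) auto

text \<open>\<open>frac\<close> is continuous away from the integers, so the comparison can change
  only where the value is 0 or \<theta>.\<close>

lemma eventually_frac_le:
  fixes h :: "'a::t2_space \<Rightarrow> real"
  assumes "isCont h P" "frac (h P) \<noteq> 0" "frac (h P) \<noteq> \<theta>"
  shows "\<forall>\<^sub>F w in nhds P. (frac (h w) \<le> \<theta>) = (frac (h P) \<le> \<theta>)"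
proof -
  have lim: "((\<lambda>w. frac (h w)) \<longlongrightarrow> frac (h P)) (nhds P)"
    using isCont_frac_comp[OF assms(1,2)] unfolding continuous_at
      by (simp add: tendsto_at_iff_tendsto_nhds[where g = "\<lambda>w. frac (h w)"])
  show ?thesis
  proof (cases "frac (h P) < \<theta>")
    case True
    from order_tendstoD(2)[OF lim this] show ?thesis
      by eventually_elim (use True in simp)
  next
    case False
    then have "\<theta> < frac (h P)" using assms by simp
    from order_tendstoD(1)[OF lim this] show ?thesis
      by eventually_elim (use \<open>\<theta> < frac (h P)\<close> in simp)
  qed
qed

context twist
begin

text \<open>\<open>R\<close> is closed in the torus: outside it both coordinates exceed a positive
  bound strictly, and this persists nearby. It guarantees that boundary points have genuine backward
  orbits under \<open>Minv\<close>.\<close>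

lemma torus_frontier_subset_R:
  assumes "A \<subseteq> R"
  shows "torus_frontier A \<subseteq> R"
proof
  fix z assume "z \<in> torus_frontier A"
  then obtain P where P: "P \<in> frontier (torus_proj -` A)" "z = torus_proj P"
    by (auto simp: torus_frontier_def)
  show "z \<in> R"
  proof (rule ccontr)
    assume "z \<notin> R"
    then have *: "\<alpha> < frac (fst P)" "\<beta> < frac (snd P)"
      unfolding P torus_proj_in_R by auto
    have "\<forall>\<^sub>F w in nhds P. (frac (fst w) \<le> \<alpha>) = (frac (fst P) \<le> \<alpha>)"
      by (rule eventually_frac_le) (use * \<alpha> in \<open>auto simp del: frac_eq_0_iff\<close>)
    moreover have "\<forall>\<^sub>F w in nhds P. (frac (snd w) \<le> \<beta>) = (frac (snd P) \<le> \<beta>)"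
      by (rule eventually_frac_le) (use * \<beta> in \<open>auto simp del: frac_eq_0_iff\<close>)
    ultimately have "\<forall>\<^sub>F w in nhds P. (w \<in> torus_proj -` A) = False"
    proof eventually_elim
      case (elim w)
      with * have "torus_proj w \<notin> R" unfolding torus_proj_in_R by simp
      then show ?case using assms by auto
    qed
    then have "P \<notin> frontier (torus_proj -` A)" by (rule not_frontierI)
    then show False using P(1) by contradiction
  qed
qed

lemma ltm_boundary_subset_R: "ltm_boundary \<alpha> \<beta> \<kappa> \<subseteq> R"
  unfolding ltm_boundary_def by (intro Un_least torus_frontier_subset_R) (auto simp: ltm_domain_def)

lemma torus_proj_in_R_L:
    "torus_proj w \<in> R_L \<alpha> \<beta> \<kappa> \<longleftrightarrow>
      frac (fst w) \<le> \<alpha> \<and> frac (snd w + \<kappa> * frac (fst w)) \<le> \<beta>"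
  and torus_proj_in_R_V:
    "torus_proj w \<in> R_V \<alpha> \<beta> \<kappa> \<longleftrightarrow>
      frac (fst w) \<le> \<alpha> \<and> \<not> frac (snd w + \<kappa> * frac (fst w)) \<le> \<beta>"
  and torus_proj_in_R_H:
    "torus_proj w \<in> R_H \<alpha> \<beta> \<longleftrightarrow> \<not> frac (fst w) \<le> \<alpha> \<and> frac (snd w) \<le> \<beta>"
  by (simp_all add: R_L_def R_V_def R_H_def torus_proj_def unit_square_def frac_lt_1 not_le)

text \<open>Each inequality defining the three regions is strict at such a point and off the jump of
  \<open>frac\<close>, so membership is locally constant. The sheared coordinate enters the
  definitions only over the vertical strip, hence the premise of \<open>F\<close>.\<close>

lemma not_in_boundary:
  assumes z: "0 < fst z" "fst z < 1" "fst z \<noteq> \<alpha>" "0 < snd z" "snd z < 1" "snd z \<noteq> \<beta>"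
    and F: "fst z < \<alpha> \<Longrightarrow> frac (snd z + \<kappa> * fst z) \<notin> {0, \<beta>}"
  shows "z \<notin> ltm_boundary \<alpha> \<beta> \<kappa>"
proof -
  have "z \<notin> torus_frontier A"
    if A: "A \<in> {R_L \<alpha> \<beta> \<kappa>, R_V \<alpha> \<beta> \<kappa>, R_H \<alpha> \<beta>}" for A
  proof
    assume "z \<in> torus_frontier A"
    then obtain P where P: "P \<in> frontier (torus_proj -` A)" "z = torus_proj P"
      by (auto simp: torus_frontier_def)
    let ?h = "\<lambda>w. snd w + \<kappa> * frac (fst w)"
    have fP: "fst z = frac (fst P)" "snd z = frac (snd P)" by (simp_all add: P)
    have "\<forall>\<^sub>F w in nhds P. (frac (fst w) \<le> \<alpha>) = (fst z \<le> \<alpha>)"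
      using z unfolding fP by (intro eventually_frac_le) simp_all
    moreover have "\<forall>\<^sub>F w in nhds P. (frac (snd w) \<le> \<beta>) = (snd z \<le> \<beta>)"
      using z unfolding fP by (intro eventually_frac_le) simp_all
    moreover have "\<forall>\<^sub>F w in nhds P. fst z \<le> \<alpha> \<longrightarrow> (frac (?h w) \<le> \<beta>) = (frac (?h P) \<le> \<beta>)"
    proof (cases "fst z \<le> \<alpha>")
      case True
      have "frac (?h P) = frac (snd z + \<kappa> * fst z)" by (simp add: fP)
      moreover have "fst z < \<alpha>" using True z(3) by simp
      note F[OF this]
      ultimately have nz: "frac (?h P) \<noteq> 0" "frac (?h P) \<noteq> \<beta>" by simp_all
      have "isCont (\<lambda>w. frac (fst w)) P"
        using z(1) unfolding fP by (intro isCont_frac_comp) simp_all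
      then have "isCont ?h P" by (intro continuous_intros) simp_all
      then have "\<forall>\<^sub>F w in nhds P. (frac (?h w) \<le> \<beta>) = (frac (?h P) \<le> \<beta>)"
        using nz by (rule eventually_frac_le)
      then show ?thesis by eventually_elim simp
    qed simp
    ultimately have "\<forall>\<^sub>F w in nhds P. (w \<in> torus_proj -` A) = (P \<in> torus_proj -` A)"
    proof eventually_elim
      case (elim w)
      consider "A = R_L \<alpha> \<beta> \<kappa>" | "A = R_V \<alpha> \<beta> \<kappa>" | "A = R_H \<alpha> \<beta>"
        using A by blast
      then show ?case
      proof cases
        case 1
        show ?thesis unfolding 1 vimage_eq torus_proj_in_R_L using elim[unfolded fP] by argo
      next
        case 2
        show ?thesis unfolding 2 vimage_eq torus_proj_in_R_V using elim[unfolded fP] by argo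
      next
        case 3
        show ?thesis unfolding 3 vimage_eq torus_proj_in_R_H using elim[unfolded fP] by argo
      qed
    qed
    then have "P \<notin> frontier (torus_proj -` A)" by (rule not_frontierI)
    then show False using P(1) by contradiction
  qed
  then show ?thesis unfolding ltm_boundary_def by blast
qed

text \<open>\<open>M\<close> is injective on \<open>R\<close> and permutes \<open>C\<close>, so a
  point of \<open>R\<close> with one iterate in \<open>C\<close>, forward or backward, lies in
  \<open>C\<close> itself. A singular point of \<open>C\<close> would thus put a boundary point into
  \<open>C\<close>.\<close>

lemma not_in_singular_set:
  assumes inv: "C \<subseteq> R" "M ` C = C" and disj: "C \<inter> ltm_boundary \<alpha> \<beta> \<kappa> = {}"
  shows "C \<inter> singular_set \<alpha> \<beta> \<kappa> lam = {}"
proof -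
  have pre: "Minv z \<in> C" if "z \<in> C" for z
  proof -
    have "z \<in> M ` C" using that by (simp only: inv(2))
    then obtain w where "w \<in> C" "M w = z" by (elim imageE) simp
    then show ?thesis using ltm_inv_ltm[of w] subsetD[OF inv(1)] by auto
  qed
  have fwd: "b \<in> C" if "(M ^^ n) b \<in> C" "b \<in> R" for n b
    using that
  proof (induction n)
    case (Suc n)
    then have "Minv (M ((M ^^ n) b)) \<in> C" using pre by simp
    then show ?case using Suc by (simp add: ltm_inv_ltm ltm_pow_R)
  qed simp
  have bwd: "b \<in> C" if "(Minv ^^ n) b \<in> C" "b \<in> R" for n b
    using that
  proof (induction n arbitrary: b)
    case (Suc n)
    then have "Minv b \<in> C" using ltm_inv_R by (simp add: funpow_swap1)
    then have "M (Minv b) \<in> C" by (subst inv(2)[symmetric]) (rule imageI)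
    then show ?case using Suc by (simp add: ltm_ltm_inv)
  qed simp
  show ?thesis
  proof (rule equals0I)
    fix z assume "z \<in> C \<inter> singular_set \<alpha> \<beta> \<kappa> lam"
    then obtain n b where "z \<in> C" "b \<in> ltm_boundary \<alpha> \<beta> \<kappa>" "z = (M ^^ n) b \<or> z = (Minv ^^ n) b"
      unfolding singular_set_def by auto
    moreover from this have "b \<in> R" using ltm_boundary_subset_R by blast
    ultimately have "b \<in> C" using fwd bwd by metis
    then show False using \<open>b \<in> ltm_boundary \<alpha> \<beta> \<kappa>\<close> disj by blast
  qed
qed

end

subsection \<open>Segments with an affine backward orbit\<close>

text \<open>With \<open>r\<close> the \<open>N\<close>-th root of \<open>q\<close>, the quotient of
  \<open>D n\<close> by \<open>r ^ n\<close> is \<open>N\<close>-periodic, so its maximum over one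
  period serves as \<open>C\<close>.\<close>

lemma exponential_bound_of_periodic_contraction:
  fixes D :: "nat \<Rightarrow> real"
  assumes "0 < N" "0 < q" "q < 1" and D: "\<And>n. 0 \<le> D n" "\<And>n. D (n + N) = q * D n"
  shows "\<exists>C r. 0 < r \<and> r < 1 \<and> (\<forall>n. D n \<le> C * r ^ n)"
proof (intro exI conjI allI)
  let ?r = "root N q"
  let ?C = "Max ((\<lambda>s. D s / ?r ^ s) ` {..<N})"
  show r: "0 < ?r" "?r < 1"
    using assms by simp_all
  show "D n \<le> ?C * ?r ^ n" for n
  proof (induction n rule: less_induct)
    case (less n)
    show ?case
    proof (cases "n < N")
      case True
      then have "D n / ?r ^ n \<le> ?C" by (intro Max_ge) auto
      then show ?thesis using r by (simp add: divide_le_eq)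
    next
      case False
      have "D n = ?r ^ N * D (n - N)"
        using D(2)[of "n - N"] False assms by simp
      also have "\<dots> \<le> ?r ^ N * (?C * ?r ^ (n - N))"
        using less[of "n - N"] False assms r by (intro mult_left_mono) auto
      also have "\<dots> = ?C * ?r ^ n"
        using False by (simp add: mult_ac flip: power_add)
      finally show ?thesis .
    qed
  qed
qed

text \<open>By Lagrange's identity the nonzero determinant makes the Cauchy-Schwarz inequality
  strict, which excludes the angle 0.\<close>

lemma vec_angle_acute:
  assumes "v \<bullet> w > 0" "fst v * snd w - snd v * fst w \<noteq> 0"
  shows "0 < vec_angle v w" "vec_angle v w < pi / 2"
proof -
  let ?c = "fst v * snd w - snd v * fst w"
  have nz: "v \<noteq> 0" "w \<noteq> 0" using assms by auto
  have "(v \<bullet> w)\<^sup>2 + ?c\<^sup>2 = (norm v * norm w)\<^sup>2"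
    by (simp add: power_mult_distrib power2_norm_eq_inner inner_prod_def)
      (simp add: power2_eq_square algebra_simps)
  moreover have "?c\<^sup>2 > 0" using assms by simp
  ultimately have "(v \<bullet> w)\<^sup>2 < (norm v * norm w)\<^sup>2" by linarith
  then have "v \<bullet> w < norm v * norm w" by (rule power_less_imp_less_base) simp
  then have 1: "(v \<bullet> w) / (norm v * norm w) < 1" using nz by simp
  have 2: "0 < (v \<bullet> w) / (norm v * norm w)" using assms nz by simp
  show "vec_angle v w < pi / 2"
    using arccos_less_arccos[of 0 "(v \<bullet> w) / (norm v * norm w)"] 1 2 by (simp add: vec_angle_def)
  show "0 < vec_angle v w"
    using arccos_less_arccos[of "(v \<bullet> w) / (norm v * norm w)" 1] 1 2 by (simp add: vec_angle_def)
qed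

text \<open>The parameter is not arc length: expansion is stored in \<open>d\<close>. A segment and
  its affine images therefore share one parameter interval, and equal parameters mark corresponding
  points.\<close>

definition seg :: "real \<times> real \<Rightarrow> real \<times> real \<Rightarrow> real \<Rightarrow> real \<times> real" where
  "seg q d t = torus_proj (q + t *\<^sub>R d)"

lemma affine_param:
  fixes q d :: "'a::real_vector"
  shows "(1 - s) *\<^sub>R (q - \<delta> *\<^sub>R d) + s *\<^sub>R (q + \<delta> *\<^sub>R d) = q + ((2 * s - 1) * \<delta>) *\<^sub>R d"
proof -
  have "(1 - s) *\<^sub>R (q - \<delta> *\<^sub>R d) + s *\<^sub>R (q + \<delta> *\<^sub>R d) =
      ((1 - s) + s) *\<^sub>R q + (s * \<delta> - (1 - s) * \<delta>) *\<^sub>R d"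
    by (simp only: scaleR_add_left scaleR_diff_left scaleR_add_right scaleR_diff_right scaleR_scaleR)
      (simp add: algebra_simps)
  then show ?thesis by (simp add: algebra_simps)
qed

text \<open>The clause \<open>d \<noteq> 0\<close> inside the set covers the degenerate case, in
  which the open segment is empty.\<close>

lemma seg_open_segment:
  assumes "0 < \<delta>"
  shows "torus_proj ` open_segment (q - \<delta> *\<^sub>R d) (q + \<delta> *\<^sub>R d) = {seg q d t | t. \<bar>t\<bar> < \<delta> \<and> d \<noteq> 0}"
proof (cases "d = 0")
  case False
  have ex: "\<exists>s. 0 < s \<and> s < 1 \<and> t = (2 * s - 1) * \<delta>" if "\<bar>t\<bar> < \<delta>" for t
    using that assms by (intro exI[of _ "(t / \<delta> + 1) / 2"]) (auto simp: field_simps)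
  have small: "\<bar>(2 * s - 1) * \<delta>\<bar> < \<delta>" if "0 < s" "s < 1" for s
    using that assms by (simp add: abs_mult)
  have "q - \<delta> *\<^sub>R d \<noteq> q + \<delta> *\<^sub>R d"
    using False assms by (auto simp: prod_eq_iff)
  then have "torus_proj ` open_segment (q - \<delta> *\<^sub>R d) (q + \<delta> *\<^sub>R d) =
      (\<lambda>s. seg q d ((2 * s - 1) * \<delta>)) ` {0<..<1}"
    by (simp add: open_segment_image_interval image_image affine_param seg_def)
  also have "\<dots> = {seg q d t | t. \<bar>t\<bar> < \<delta>}"
  proof (intro subset_antisym subsetI)
    fix x assume "x \<in> (\<lambda>s. seg q d ((2 * s - 1) * \<delta>)) ` {0<..<1}"
    then obtain s where "0 < s" "s < 1" "x = seg q d ((2 * s - 1) * \<delta>)" by auto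
    with small show "x \<in> {seg q d t | t. \<bar>t\<bar> < \<delta>}" by blast
  next
    fix x assume "x \<in> {seg q d t | t. \<bar>t\<bar> < \<delta>}"
    then obtain t where "\<bar>t\<bar> < \<delta>" "x = seg q d t" by blast
    with ex obtain s where "0 < s" "s < 1" "x = seg q d ((2 * s - 1) * \<delta>)" by blast
    then show "x \<in> (\<lambda>s. seg q d ((2 * s - 1) * \<delta>)) ` {0<..<1}" by auto
  qed
  finally show ?thesis using False by simp
qed simp

section \<open>Parametrised unstable segments\<close>

context twist
begin

text \<open>Base point and direction are packed into a pair so that a full period of the orbit can
  be expressed by the transitive closure.\<close>

fun mstep :: "real \<Rightarrow> (real \<times> real) \<times> (real \<times> real) \<Rightarrow> (real \<times> real) \<times> (real \<times> real) \<Rightarrow> bool" where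
  "mstep \<delta> (q, d) (q', d') \<longleftrightarrow>
    (\<forall>t. \<bar>t\<bar> < \<delta> \<longrightarrow> seg q d t \<in> R \<and> M (seg q d t) = seg q' d' t)"

text \<open>The backward orbit is recorded through forward steps, so that applying \<open>M\<close>
  once more just prepends a term to \<open>Q\<close> and \<open>E\<close>.\<close>

definition unstable_seg :: "real \<times> real \<Rightarrow> real \<times> real \<Rightarrow> real \<Rightarrow> bool" where
  "unstable_seg q d \<delta> \<longleftrightarrow> d \<noteq> 0 \<and> 0 < \<delta> \<and>
    (\<forall>t. \<bar>t\<bar> < \<delta> \<longrightarrow> seg q d t \<in> R) \<and>
    (\<exists>Q E C r. Q 0 = q \<and> E 0 = d \<and> 0 < r \<and> r < 1 \<and> (\<forall>n. norm (E n) \<le> C * r ^ n) \<and>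
      (\<forall>n. mstep \<delta> (Q (Suc n), E (Suc n)) (Q n, E n)))"

lemma mstep_mono: "mstep \<delta> x y \<Longrightarrow> \<delta>' \<le> \<delta> \<Longrightarrow> mstep \<delta>' x y"
  by (cases x; cases y) auto

lemma unstable_segE:
  assumes "unstable_seg q d \<delta>"
  obtains Q E C r where "Q 0 = q" "E 0 = d" "0 < r" "r < 1" "\<And>n. norm (E n) \<le> C * r ^ n"
    "\<And>n. mstep \<delta> (Q (Suc n), E (Suc n)) (Q n, E n)"
  using assms unfolding unstable_seg_def by blast

lemma unstable_segI:
  assumes "Q 0 = q" "E 0 = d" "0 < r" "r < 1" "\<And>n. norm (E n) \<le> C * r ^ n"
    "\<And>n. mstep \<delta> (Q (Suc n), E (Suc n)) (Q n, E n)" "d \<noteq> 0" "0 < \<delta>"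
    "\<And>t. \<bar>t\<bar> < \<delta> \<Longrightarrow> seg q d t \<in> R"
  shows "unstable_seg q d \<delta>"
  using assms unfolding unstable_seg_def by blast

lemma unstable_segD:
  assumes "unstable_seg q d \<delta>"
  shows "d \<noteq> 0" "0 < \<delta>" "\<bar>t\<bar> < \<delta> \<Longrightarrow> seg q d t \<in> R"
  using assms unfolding unstable_seg_def by blast+

lemma unstable_seg_mono:
  assumes "unstable_seg q d \<delta>" "0 < \<delta>'" "\<delta>' \<le> \<delta>"
  shows "unstable_seg q d \<delta>'"
  using assms(1)
proof (rule unstable_segE)
  fix Q E C r
  assume *: "Q 0 = q" "E 0 = d" "0 < r" "r < 1" "\<And>n. norm (E n) \<le> C * r ^ n"
    "\<And>n. mstep \<delta> (Q (Suc n), E (Suc n)) (Q n, E n)"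
  show ?thesis
  proof (rule unstable_segI[of Q q E d r C])
    show "mstep \<delta>' (Q (Suc n), E (Suc n)) (Q n, E n)" for n
      using mstep_mono[OF *(6) assms(3)] .
    show "seg q d t \<in> R" if "\<bar>t\<bar> < \<delta>'" for t
      using unstable_segD(3)[OF assms(1)] that assms(3) by simp
  qed (use * assms(2) unstable_segD(1)[OF assms(1)] in blast)+
qed

lemma unstable_seg_push:
  assumes "unstable_seg q d \<delta>" "mstep \<delta> (q, d) (q', d')" "d' \<noteq> 0"
  shows "unstable_seg q' d' \<delta>"
  using assms(1)
proof (rule unstable_segE)
  fix Q E C r
  assume *: "Q 0 = q" "E 0 = d" "0 < r" "r < 1" "\<And>n. norm (E n) \<le> C * r ^ n"
    "\<And>n. mstep \<delta> (Q (Suc n), E (Suc n)) (Q n, E n)"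
  have "0 \<le> C" using order_trans[OF norm_ge_zero *(5)[of 0]] by simp
  \<comment> \<open>Prepending delays the old sequence by one index, which costs a factor
    \<open>1 / r\<close>; the maximum also covers the new first term.\<close>
  have "norm (case_nat d' E n) \<le> max (norm d') (C / r) * r ^ n" for n
  proof (cases n)
    case (Suc m)
    have "norm (E m) \<le> C / r * r ^ n" using *(5)[of m] \<open>0 < r\<close> Suc by simp
    also have "\<dots> \<le> max (norm d') (C / r) * r ^ n"
      using \<open>0 < r\<close> by (intro mult_right_mono) auto
    finally show ?thesis using Suc by simp
  qed simp
  moreover have "mstep \<delta> (case_nat q' Q (Suc n), case_nat d' E (Suc n)) (case_nat q' Q n, case_nat d' E n)" for n
    using *(1,2,6) assms(2) by (cases n) (auto simp del: mstep.simps)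
  moreover have "seg q' d' t \<in> R" if "\<bar>t\<bar> < \<delta>" for t
    using assms(2) ltm_R that by (metis mstep.simps)
  ultimately show ?thesis
    using *(3,4) assms(3) unstable_segD(2)[OF assms(1)]
    by (intro unstable_segI[of "case_nat q' Q" _ "case_nat d' E" _ r "max (norm d') (C / r)"])
      (simp_all del: mstep.simps)
qed

lemma unstable_seg_imp_local_unstable_segment:
  assumes "unstable_seg q d \<delta>" "\<bar>t\<bar> < \<delta>"
  shows "local_unstable_segment \<alpha> \<beta> \<kappa> lam (seg q d t) {seg q d t | t. \<bar>t\<bar> < \<delta>}"
  using assms(1)
proof (rule unstable_segE)
  fix Q E C r
  assume *: "Q 0 = q" "E 0 = d" "0 < r" "r < 1" "\<And>n. norm (E n) \<le> C * r ^ n"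
    "\<And>n. mstep \<delta> (Q (Suc n), E (Suc n)) (Q n, E n)"
  note d = unstable_segD(1,2)[OF assms(1)]
  note inR = unstable_segD(3)[OF assms(1)]
  have inv: "(Minv ^^ n) (seg q d t) = seg (Q n) (E n) t" if "\<bar>t\<bar> < \<delta>" for n t
  proof (induction n)
    case (Suc n)
    have "seg (Q (Suc n)) (E (Suc n)) t \<in> R" "M (seg (Q (Suc n)) (E (Suc n)) t) = seg (Q n) (E n) t"
      using *(6)[of n] that by auto
    then show ?case using Suc ltm_inv_ltm by (metis comp_apply funpow.simps(2))
  qed (simp add: *)
  have small: "\<bar>(2 * s - 1) * \<delta>\<bar> < \<delta>" if "0 < s" "s < 1" for s
    using that d by (simp add: abs_mult)
  have "maps_segment_affinely (Minv ^^ n) (q - \<delta> *\<^sub>R d) (q + \<delta> *\<^sub>R d)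
      (Q n - \<delta> *\<^sub>R E n) (Q n + \<delta> *\<^sub>R E n)" for n
    unfolding maps_segment_affinely_def affine_param using inv small by (simp add: seg_def)
  moreover have "dist (Q n - \<delta> *\<^sub>R E n) (Q n + \<delta> *\<^sub>R E n) \<le> (2 * \<delta> * C) * r ^ n" for n
  proof -
    have "(Q n - \<delta> *\<^sub>R E n) - (Q n + \<delta> *\<^sub>R E n) = (- (2 * \<delta>)) *\<^sub>R E n"
      by (simp add: prod_eq_iff algebra_simps)
    then have "dist (Q n - \<delta> *\<^sub>R E n) (Q n + \<delta> *\<^sub>R E n) = 2 * \<delta> * norm (E n)"
      using d by (simp add: dist_norm)
    also have "\<dots> \<le> 2 * \<delta> * (C * r ^ n)"
      using *(5) d by (intro mult_left_mono) auto
    finally show ?thesis by (simp add: mult_ac)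
  qed
  moreover have "q - \<delta> *\<^sub>R d \<noteq> q + \<delta> *\<^sub>R d"
    using d by (auto simp: prod_eq_iff)
  ultimately show ?thesis
    using assms(2) inR d * unfolding local_unstable_segment_def
    by (intro conjI exI[of _ "q - \<delta> *\<^sub>R d"] exI[of _ "q + \<delta> *\<^sub>R d"]
        exI[of _ "\<lambda>n. Q n - \<delta> *\<^sub>R E n"] exI[of _ "\<lambda>n. Q n + \<delta> *\<^sub>R E n"]
        exI[of _ "2 * \<delta> * C"] exI[of _ r]) (auto simp: seg_open_segment)
qed

lemma seg_scaleR: "seg q (c *\<^sub>R d) t = seg q d (c * t)"
  by (simp add: seg_def mult.commute)

text \<open>Running round the cycle backwards and dividing by \<mu> in every round gives the
  contracting backward orbit. Since the scaling factors have modulus at most 1, the parameters never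
  leave the interval on which the cycle is affine.\<close>

lemma unstable_seg_of_cycle:
  assumes chain: "(mstep T)\<^sup>+\<^sup>+ (q, d) (q, \<mu> *\<^sub>R d)" and \<mu>: "\<bar>\<mu>\<bar> > 1" and T: "0 < T" and d: "d \<noteq> 0"
  shows "unstable_seg q d T"
proof -
  obtain N h where N: "0 < N" and h: "h 0 = (q, d)" "h N = (q, \<mu> *\<^sub>R d)"
    "\<And>i. i < N \<Longrightarrow> mstep T (h i) (h (Suc i))"
    using chain by (auto simp: tranclp_power relpowp_fun_conv)
  \<comment> \<open>The indices run \<open>N\<close>, \<open>N - 1\<close>, ..., 1 and then start
    again at \<open>N\<close>. The base point is represented by \<open>h N\<close> instead of
    \<open>h 0\<close>; its direction carries a factor \<mu>, which the exponent
    \<open>Suc (n div N)\<close> compensates.\<close>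
  define i where "i n = N - n mod N" for n
  define c where "c n = inverse \<mu> ^ Suc (n div N)" for n
  define Q where "Q n = fst (h (i n))" for n
  define E where "E n = c n *\<^sub>R snd (h (i n))" for n
  have c: "\<bar>c n * t\<bar> < T" if "\<bar>t\<bar> < T" for n t
  proof -
    have "\<bar>c n\<bar> \<le> 1" using \<mu> unfolding c_def power_abs abs_inverse
      by (intro power_le_one) (auto simp: inverse_eq_divide)
    then have "\<bar>c n * t\<bar> \<le> 1 * \<bar>t\<bar>" unfolding abs_mult by (intro mult_right_mono) auto
    then show ?thesis using that by simp
  qed
  have step: "seg (fst (h j)) (snd (h j)) t \<in> R \<and>
      M (seg (fst (h j)) (snd (h j)) t) = seg (fst (h (Suc j))) (snd (h (Suc j))) t"
    if "j < N" "\<bar>t\<bar> < T" for j t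
    using h(3)[OF that(1)] that(2) by (metis mstep.simps prod.collapse)
  have "mstep T (Q (Suc n), E (Suc n)) (Q n, E n)" for n
  proof (cases "Suc n mod N = 0")
    case False
    then have m: "Suc n mod N = Suc (n mod N)" "Suc n div N = n div N"
      by (auto simp: mod_Suc div_Suc split: if_splits)
    then have "Suc (i (Suc n)) = i n" "i (Suc n) < N"
      using N by (auto simp: i_def Suc_diff_Suc)
    then show ?thesis
      using step[of "i (Suc n)"] c[of _ n] m by (auto simp: Q_def E_def seg_scaleR c_def simp del: power_Suc)
  next
    case True
    then have m: "n mod N = N - 1" "Suc n div N = Suc (n div N)"
      by (auto simp: mod_Suc div_Suc split: if_splits)
    then have i: "i (Suc n) = N" "i n = 1" using True N by (auto simp: i_def)
    have "c (Suc n) *\<^sub>R \<mu> *\<^sub>R d = c n *\<^sub>R d"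
      using \<mu> m by (simp add: c_def) 
    then have "E (Suc n) = c n *\<^sub>R d" "Q (Suc n) = q"
      using h by (simp_all add: E_def Q_def i)
    moreover have "E n = c n *\<^sub>R snd (h 1)" "Q n = fst (h 1)"
      by (simp_all add: E_def Q_def i)
    ultimately show ?thesis
      using step[of 0 "c n * _"] c[of _ n] h(1) N by (simp only: mstep.simps seg_scaleR) simp
  qed
  moreover have "Q 0 = q" "E 0 = d"
    using h \<mu> by (auto simp: Q_def E_def i_def c_def)
  moreover have "\<exists>C r. 0 < r \<and> r < 1 \<and> (\<forall>n. norm (E n) \<le> C * r ^ n)"
  proof (rule exponential_bound_of_periodic_contraction[OF N, of "inverse \<bar>\<mu>\<bar>"])
    show "norm (E (n + N)) = inverse \<bar>\<mu>\<bar> * norm (E n)" for n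
      using N by (simp add: E_def c_def i_def abs_mult)
  qed (use \<mu> in \<open>auto simp: inverse_less_1_iff\<close>)
  moreover have "seg q d t \<in> R" if "\<bar>t\<bar> < T" for t
    using step[of 0 t] h N that by simp
  ultimately show ?thesis
    using T d unfolding unstable_seg_def by blast
qed

text \<open>The vertex is the image of the parameter \<open>t0\<close>, and \<rho> rescales time so
  that the branches leave it with velocities \<open>v\<close> and \<open>w\<close>. The segment at
  \<open>q'\<close> supplies the local unstable segment that must exist at the nonsingular base
  point itself.\<close>

lemma kinkI:
  assumes u: "unstable_seg q d \<delta>" and ns: "(M ^^ n) (seg q d 0) \<notin> singular_set \<alpha> \<beta> \<kappa> lam"
    and u': "unstable_seg q' d' \<delta>'" "seg q' d' 0 = (M ^^ n) (seg q d 0)"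
    and \<epsilon>: "0 < \<epsilon>" and branches:
      "\<And>\<tau>. 0 \<le> \<tau> \<Longrightarrow> \<tau> \<le> \<epsilon> \<Longrightarrow> \<bar>t0 + \<tau> * \<rho>\<bar> < \<delta> \<and> (M ^^ n) (seg q d (t0 + \<tau> * \<rho>)) = seg p v \<tau>"
      "\<And>\<tau>. 0 \<le> \<tau> \<Longrightarrow> \<tau> \<le> \<epsilon> \<Longrightarrow> \<bar>t0 - \<tau> * \<rho>\<bar> < \<delta> \<and> (M ^^ n) (seg q d (t0 - \<tau> * \<rho>)) = seg p w \<tau>"
    and angle: "v \<bullet> w > 0" "fst v * snd w - snd v * fst w \<noteq> 0"
  shows "unstable_manifold_has_kinks \<alpha> \<beta> \<kappa> lam"
proof -
  define z where "z = (M ^^ n) (seg q d 0)"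
  define \<gamma> where "\<gamma> = {seg q d t | t. \<bar>t\<bar> < \<delta>}"
  have R: "seg q d 0 \<in> R" using u by (auto simp: unstable_seg_def)
  have z: "z \<in> R - singular_set \<alpha> \<beta> \<kappa> lam"
    using R ns ltm_pow_R by (simp add: z_def)
  have "local_unstable_segment \<alpha> \<beta> \<kappa> lam ((Minv ^^ n) z) \<gamma>"
    using unstable_seg_imp_local_unstable_segment[OF u, of 0] u R
    by (simp add: z_def ltm_inv_pow_ltm_pow \<gamma>_def unstable_seg_def)
  then have arc: "(M ^^ n) ` \<gamma> \<in> unstable_arcs \<alpha> \<beta> \<kappa> lam z"
    by (auto simp: unstable_arcs_def)
  have sub: "torus_proj ` closed_segment p (p + \<epsilon> *\<^sub>R e) \<subseteq> (M ^^ n) ` \<gamma>"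
    if "\<And>\<tau>. 0 \<le> \<tau> \<Longrightarrow> \<tau> \<le> \<epsilon> \<Longrightarrow> \<bar>t0 + \<tau> * \<sigma>\<bar> < \<delta> \<and> (M ^^ n) (seg q d (t0 + \<tau> * \<sigma>)) = seg p e \<tau>" for e \<sigma>
  proof (rule image_subsetI)
    fix x assume "x \<in> closed_segment p (p + \<epsilon> *\<^sub>R e)"
    then obtain s where s: "0 \<le> s" "s \<le> 1" "x = (1 - s) *\<^sub>R p + s *\<^sub>R (p + \<epsilon> *\<^sub>R e)"
      by (auto simp: in_segment)
    have "(1 - s) *\<^sub>R p + s *\<^sub>R (p + \<epsilon> *\<^sub>R e) = p + (s * \<epsilon>) *\<^sub>R e"
      by (simp add: prod_eq_iff algebra_simps)
    then have "torus_proj x = seg p e (s * \<epsilon>)" unfolding s(3) seg_def by simp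
    moreover have "0 \<le> s * \<epsilon>" "s * \<epsilon> \<le> \<epsilon>" using s \<epsilon> by (auto simp: mult_left_le_one_le)
    ultimately show "torus_proj x \<in> (M ^^ n) ` \<gamma>"
      using that[of "s * \<epsilon>"] unfolding \<gamma>_def
      by (intro image_eqI[of _ _ "seg q d (t0 + s * \<epsilon> * \<sigma>)"]) auto
  qed
  have sub_v: "torus_proj ` closed_segment p (p + \<epsilon> *\<^sub>R v) \<subseteq> (M ^^ n) ` \<gamma>"
    by (rule sub[OF branches(1)])
  have sub_w: "torus_proj ` closed_segment p (p + \<epsilon> *\<^sub>R w) \<subseteq> (M ^^ n) ` \<gamma>"
    using branches(2) by (intro sub[of "- \<rho>"]) simp
  have ang: "(\<epsilon> *\<^sub>R v) \<bullet> (\<epsilon> *\<^sub>R w) > 0"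
    "fst (\<epsilon> *\<^sub>R v) * snd (\<epsilon> *\<^sub>R w) - snd (\<epsilon> *\<^sub>R v) * fst (\<epsilon> *\<^sub>R w) \<noteq> 0"
    using angle \<epsilon> by (auto simp: algebra_simps)
  have "torus_proj p \<in> (M ^^ n) ` \<gamma>" using sub_v by auto
  then have "torus_proj p \<in> unstable_manifold \<alpha> \<beta> \<kappa> lam z"
    using arc by (auto simp: unstable_manifold_def)
  moreover have "kink_of (unstable_arcs \<alpha> \<beta> \<kappa> lam z) (torus_proj p)"
    using arc sub_v sub_w vec_angle_acute[OF ang] angle \<epsilon>
    unfolding kink_of_def
    by (intro bexI[of _ "(M ^^ n) ` \<gamma>"] exI[of _ p] exI[of _ "\<epsilon> *\<^sub>R v"] exI[of _ "\<epsilon> *\<^sub>R w"]) auto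
  moreover have "\<exists>\<gamma>. local_unstable_segment \<alpha> \<beta> \<kappa> lam z \<gamma>"
    using unstable_seg_imp_local_unstable_segment[OF u'(1), of 0] u' by (auto simp: z_def unstable_seg_def)
  ultimately show ?thesis
    using z unfolding unstable_manifold_has_kinks_def by blast
qed

end

subsection \<open>The periodic orbit through the centre of the strips\<close>

lemma abs_mult_le:
  fixes t u c \<delta> :: real
  assumes "\<bar>u\<bar> * \<delta> \<le> c" "\<bar>t\<bar> < \<delta>"
  shows "\<bar>t * u\<bar> \<le> c"
proof -
  have "\<bar>t\<bar> * \<bar>u\<bar> \<le> \<delta> * \<bar>u\<bar>" using assms(2) by (intro mult_right_mono) auto
  then show ?thesis using assms(1) by (simp add: abs_mult mult.commute)
qed

lemma exists_small:
  fixes c c' u v :: real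
  assumes "0 < c" "0 < c'"
  shows "\<exists>\<delta>>0. \<bar>u\<bar> * \<delta> \<le> c \<and> \<bar>v\<bar> * \<delta> \<le> c'"
proof -
  let ?\<delta> = "min (c / (\<bar>u\<bar> + 1)) (c' / (\<bar>v\<bar> + 1))"
  have "\<bar>u\<bar> * ?\<delta> \<le> (\<bar>u\<bar> + 1) * (c / (\<bar>u\<bar> + 1))" "\<bar>v\<bar> * ?\<delta> \<le> (\<bar>v\<bar> + 1) * (c' / (\<bar>v\<bar> + 1))"
    using assms by (intro mult_mono; simp)+
  moreover have "(\<bar>u\<bar> + 1) * (c / (\<bar>u\<bar> + 1)) = c" "(\<bar>v\<bar> + 1) * (c' / (\<bar>v\<bar> + 1)) = c'"
    by (simp_all add: add_nonneg_eq_0_iff)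
  moreover have "0 < ?\<delta>" using assms by (simp add: add_nonneg_pos)
  ultimately show ?thesis by metis
qed

lemma seg_pair: "seg (x, y) (u, v) t = torus_proj (x + t * u, y + t * v)"
  by (simp add: seg_def)

lemma seg_shift:
  assumes "x - x' = of_int m" "y - y' = of_int n"
  shows "seg (x, y) d t = seg (x', y') d t"
  using assms by (cases d) (auto simp: seg_pair intro!: torus_proj_eqI[where m = m and n = n])

context twist
begin

text \<open>The central points: \<open>f\<close> exchanges \<open>po\<close> with \<open>pre\<close>, and \<open>g\<close> exchanges \<open>po\<close> with \<open>post\<close>, because
  on the core line of its strip a shear is a rotation by \<open>k\<close> resp. \<open>l\<close> half turns.\<close>

definition po where "po = (\<alpha> / 2, \<beta> / 2)"
definition pv where "pv = (\<alpha> / 2, (1 + \<beta>) / 2)"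
definition ph where "ph = ((1 + \<alpha>) / 2, \<beta> / 2)"
definition pre where "pre = (if even k then po else pv)"
definition post where "post = (if even l then po else ph)"

lemma f_seg:
  assumes "\<bar>t * u\<bar> \<le> \<alpha> / 2"
  shows "f (seg (\<alpha> / 2, y) (u, v) t) = seg (\<alpha> / 2, y + of_int k / 2) (u, v + \<kappa> * u) t"
proof -
  have "f (seg (\<alpha> / 2, y) (u, v) t) =
      torus_proj (\<alpha> / 2 + t * u, y + t * v + \<kappa> * (\<alpha> / 2 + t * u - of_int 0))"
    unfolding seg_pair using assms by (intro f_strip) auto
  then show ?thesis
    using k by (simp add: seg_pair algebra_simps)
qed

lemma g_seg:
  assumes "\<bar>t * v\<bar> \<le> \<beta> / 2"
  shows "g (seg (x, \<beta> / 2) (u, v) t) = seg (x + of_int l / 2, \<beta> / 2) (u + lam * v, v) t"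
proof -
  have "g (seg (x, \<beta> / 2) (u, v) t) =
      torus_proj (x + t * u + lam * (\<beta> / 2 + t * v - of_int 0), \<beta> / 2 + t * v)"
    unfolding seg_pair using assms by (intro g_strip) auto
  then show ?thesis
    using l by (simp add: seg_pair algebra_simps)
qed

lemma f_po:
  assumes "\<bar>t * u\<bar> \<le> \<alpha> / 2"
  shows "f (seg po (u, v) t) = seg pre (u, v + \<kappa> * u) t"
proof (cases "even k")
  case True
  then obtain j where "k = 2 * j" by blast
  then show ?thesis unfolding po_def pre_def f_seg[OF assms]
    by (auto intro!: seg_shift[where m = 0 and n = j])
next
  case False
  then obtain j where "k = 2 * j + 1" by (elim oddE)
  then show ?thesis unfolding po_def pv_def pre_def f_seg[OF assms]
    by (auto simp: field_simps intro!: seg_shift[where m = 0 and n = j])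
qed

lemma f_pre:
  assumes "\<bar>t * u\<bar> \<le> \<alpha> / 2"
  shows "f (seg pre (u, v) t) = seg po (u, v + \<kappa> * u) t"
proof (cases "even k")
  case True
  then show ?thesis using f_po[OF assms] by (simp add: pre_def)
next
  case False
  then obtain j where "k = 2 * j + 1" by (elim oddE)
  then have "seg (\<alpha> / 2, (1 + \<beta>) / 2 + of_int k / 2) d t = seg (\<alpha> / 2, \<beta> / 2) d t" for d
    by (intro seg_shift[where m = 0 and n = "j + 1"]) (simp_all add: field_simps)
  with False show ?thesis
    using f_seg[OF assms, of "(1 + \<beta>) / 2" v] by (simp only: pre_def po_def pv_def if_False)
qed

lemma g_po:
  assumes "\<bar>t * v\<bar> \<le> \<beta> / 2"
  shows "g (seg po (u, v) t) = seg post (u + lam * v, v) t"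
proof (cases "even l")
  case True
  then obtain j where "l = 2 * j" by blast
  then show ?thesis unfolding po_def post_def g_seg[OF assms]
    by (auto intro!: seg_shift[where m = j and n = 0])
next
  case False
  then obtain j where "l = 2 * j + 1" by (elim oddE)
  then show ?thesis unfolding po_def ph_def post_def g_seg[OF assms]
    by (auto simp: field_simps intro!: seg_shift[where m = j and n = 0])
qed

lemma g_post:
  assumes "\<bar>t * v\<bar> \<le> \<beta> / 2"
  shows "g (seg post (u, v) t) = seg po (u + lam * v, v) t"
proof (cases "even l")
  case True
  then show ?thesis using g_po[OF assms] by (simp add: post_def)
next
  case False
  then obtain j where "l = 2 * j + 1" by (elim oddE)
  then have "seg ((1 + \<alpha>) / 2 + of_int l / 2, \<beta> / 2) d t = seg (\<alpha> / 2, \<beta> / 2) d t" for d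
    by (intro seg_shift[where m = "j + 1" and n = 0]) (simp_all add: field_simps)
  with False show ?thesis
    using g_seg[OF assms, of "(1 + \<alpha>) / 2" u] by (simp only: post_def po_def ph_def if_False)
qed

text \<open>\<open>ph\<close> is the middle of the gap between two translates of the vertical strip,
  so (1 - \<alpha>) / 2 is its distance to the edges; \<open>pv\<close> plays the same part for the
  horizontal strip.\<close>

lemma f_ph: "\<bar>t * u\<bar> \<le> (1 - \<alpha>) / 2 \<Longrightarrow> f (seg ph (u, v) t) = seg ph (u, v) t"
  unfolding ph_def seg_pair by (rule f_outside[of 0]) (auto simp: field_simps)

lemma g_pv: "\<bar>t * v\<bar> \<le> (1 - \<beta>) / 2 \<Longrightarrow> g (seg pv (u, v) t) = seg pv (u, v) t"
  unfolding pv_def seg_pair by (rule g_outside[of 0]) (auto simp: field_simps)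

lemma torus_proj_strip_R:
  "0 \<le> x \<Longrightarrow> x \<le> \<alpha> \<Longrightarrow> torus_proj (x, y) \<in> R"
  "0 \<le> y \<Longrightarrow> y \<le> \<beta> \<Longrightarrow> torus_proj (x, y) \<in> R"
  using \<alpha> \<beta> by (simp_all add: torus_proj_in_R)

lemma seg_po_R: "\<bar>t * u\<bar> \<le> \<alpha> / 2 \<Longrightarrow> seg po (u, v) t \<in> R"
  and seg_pv_R: "\<bar>t * u\<bar> \<le> \<alpha> / 2 \<Longrightarrow> seg pv (u, v) t \<in> R"
  and seg_ph_R: "\<bar>t * v\<bar> \<le> \<beta> / 2 \<Longrightarrow> seg ph (u, v) t \<in> R"
  unfolding po_def pv_def ph_def seg_pair
  by ((rule torus_proj_strip_R(1); simp add: abs_le_iff; linarith),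
      (rule torus_proj_strip_R(1); simp add: abs_le_iff; linarith),
      (rule torus_proj_strip_R(2); simp add: abs_le_iff; linarith))

text \<open>The orbit visits \<open>po\<close>, \<open>pre\<close>, \<open>post\<close> in this
  cyclic order, where \<open>po = pre\<close> for even \<open>k\<close> and \<open>post = po\<close>
  for even \<open>l\<close>; the period is 1, 2 or 3. At \<open>pre\<close> both shears act, at
  \<open>po\<close> with odd \<open>k\<close> only \<open>f\<close>, at \<open>post\<close> with odd
  \<open>l\<close> only \<open>g\<close>.\<close>

lemma mstep_pre:
  assumes "\<bar>u\<bar> * \<delta> \<le> \<alpha> / 2" "\<bar>v + \<kappa> * u\<bar> * \<delta> \<le> \<beta> / 2"
  shows "mstep \<delta> (pre, (u, v)) (post, (u + lam * (v + \<kappa> * u), v + \<kappa> * u))"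
  unfolding mstep.simps
proof (intro allI impI)
  fix t assume "\<bar>t\<bar> < \<delta>"
  then have 1: "\<bar>t * u\<bar> \<le> \<alpha> / 2" and 2: "\<bar>t * (v + \<kappa> * u)\<bar> \<le> \<beta> / 2"
    using assms(1,2)[THEN abs_mult_le] by blast+
  have "seg pre (u, v) t \<in> R" using 1 by (simp add: pre_def seg_po_R seg_pv_R)
  then show "seg pre (u, v) t \<in> R \<and>
      M (seg pre (u, v) t) = seg post (u + lam * (v + \<kappa> * u), v + \<kappa> * u) t"
    by (simp add: ltm_eq f_pre[OF 1] g_po[OF 2])
qed

lemma mstep_po:
  assumes "odd k" "\<bar>u\<bar> * \<delta> \<le> \<alpha> / 2" "\<bar>v + \<kappa> * u\<bar> * \<delta> \<le> (1 - \<beta>) / 2"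
  shows "mstep \<delta> (po, (u, v)) (pre, (u, v + \<kappa> * u))"
  unfolding mstep.simps
proof (intro allI impI)
  fix t assume "\<bar>t\<bar> < \<delta>"
  then have 1: "\<bar>t * u\<bar> \<le> \<alpha> / 2" and 2: "\<bar>t * (v + \<kappa> * u)\<bar> \<le> (1 - \<beta>) / 2"
    using assms(2,3)[THEN abs_mult_le] by blast+
  have "seg po (u, v) t \<in> R" using 1 by (simp add: seg_po_R)
  then show "seg po (u, v) t \<in> R \<and> M (seg po (u, v) t) = seg pre (u, v + \<kappa> * u) t"
    using g_pv[OF 2] assms(1) by (simp add: ltm_eq f_po[OF 1] pre_def)
qed

lemma mstep_post:
  assumes "odd l" "\<bar>u\<bar> * \<delta> \<le> (1 - \<alpha>) / 2" "\<bar>v\<bar> * \<delta> \<le> \<beta> / 2"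
  shows "mstep \<delta> (post, (u, v)) (po, (u + lam * v, v))"
  unfolding mstep.simps
proof (intro allI impI)
  fix t assume "\<bar>t\<bar> < \<delta>"
  then have 1: "\<bar>t * u\<bar> \<le> (1 - \<alpha>) / 2" and 2: "\<bar>t * v\<bar> \<le> \<beta> / 2"
    using assms(2,3)[THEN abs_mult_le] by blast+
  have "seg post (u, v) t \<in> R" using 2 assms(1) by (simp add: post_def seg_ph_R)
  then show "seg post (u, v) t \<in> R \<and> M (seg post (u, v) t) = seg po (u + lam * v, v) t"
    using f_ph[OF 1] g_post[OF 2] assms(1) by (simp add: ltm_eq post_def)
qed

section \<open>Invariance and nonsingularity of the central orbit\<close>

definition C where "C = {po, pre, post}"

lemma C_step:
  assumes "q \<in> C" "d \<noteq> 0"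
  shows "\<exists>q'\<in>C. \<exists>d' \<delta>. d' \<noteq> 0 \<and> 0 < \<delta> \<and> mstep \<delta> (q, d) (q', d')"
proof -
  obtain u v where d: "d = (u, v)" by fastforce
  have nz: "(u, v + \<kappa> * u) \<noteq> 0" "(u + lam * v, v) \<noteq> 0" "(u + lam * (v + \<kappa> * u), v + \<kappa> * u) \<noteq> 0"
    using assms(2) d by (auto simp: zero_prod_def)
  \<comment> \<open>For even \<open>k\<close> the point \<open>po\<close> is \<open>pre\<close>. For
    even \<open>l\<close> the point \<open>post\<close> is \<open>po\<close>, and one of the first
    two cases applies.\<close>
  consider "q = pre" | "q = po" "odd k" | "q = post" "odd l"
    using assms(1) by (auto simp: C_def pre_def post_def split: if_splits)
  then show ?thesis
  proof cases
    case 1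
    obtain \<delta> where "0 < \<delta>" "\<bar>u\<bar> * \<delta> \<le> \<alpha> / 2" "\<bar>v + \<kappa> * u\<bar> * \<delta> \<le> \<beta> / 2"
      using exists_small[of "\<alpha> / 2" "\<beta> / 2"] \<alpha> \<beta> by auto
    then show ?thesis using nz mstep_pre 1 d unfolding C_def by blast
  next
    case 2
    obtain \<delta> where "0 < \<delta>" "\<bar>u\<bar> * \<delta> \<le> \<alpha> / 2" "\<bar>v + \<kappa> * u\<bar> * \<delta> \<le> (1 - \<beta>) / 2"
      using exists_small[of "\<alpha> / 2" "(1 - \<beta>) / 2"] \<alpha> \<beta> by auto
    then show ?thesis using nz mstep_po 2 d unfolding C_def by blast
  next
    case 3
    obtain \<delta> where "0 < \<delta>" "\<bar>u\<bar> * \<delta> \<le> (1 - \<alpha>) / 2" "\<bar>v\<bar> * \<delta> \<le> \<beta> / 2"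
      using exists_small[of "(1 - \<alpha>) / 2" "\<beta> / 2"] \<alpha> \<beta> by auto
    then show ?thesis using nz mstep_post 3 d unfolding C_def by blast
  qed
qed

lemma C_R: "C \<subseteq> R"
  using \<alpha> \<beta> by (auto simp: C_def po_def pre_def post_def pv_def ph_def R_iff)

lemma seg_C_0: "q \<in> C \<Longrightarrow> seg q d 0 = q"
  using C_R by (auto simp: seg_def)

lemma C_unst_step:
  assumes "unstable_seg q d \<delta>" "q \<in> C"
  shows "\<exists>d' \<delta>'. unstable_seg (M q) d' \<delta>' \<and> M q \<in> C"
proof -
  obtain q' d' \<epsilon> where *: "q' \<in> C" "d' \<noteq> 0" "0 < \<epsilon>" "mstep \<epsilon> (q, d) (q', d')"
    using C_step[OF assms(2) unstable_segD(1)[OF assms(1)]] by blast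
  have "M (seg q d 0) = seg q' d' 0" using * by auto
  then have "M q = q'" using * assms(2) by (simp add: seg_C_0)
  have "unstable_seg q d (min \<delta> \<epsilon>)"
    using assms(1) * unstable_segD(2)[OF assms(1)] by (intro unstable_seg_mono[OF assms(1)]) auto
  moreover have "mstep (min \<delta> \<epsilon>) (q, d) (q', d')"
    by (rule mstep_mono[OF *(4)]) simp
  ultimately have "unstable_seg q' d' (min \<delta> \<epsilon>)" using *(2) by (rule unstable_seg_push)
  then show ?thesis using \<open>M q = q'\<close> *(1) by blast
qed

text \<open>The segment may shrink from step to step: only its existence at the base point of the
  image arc is asked for in \<open>kinkI\<close>.\<close>

lemma C_unst_pow:
  assumes "unstable_seg q d \<delta>" "q \<in> C"
  shows "\<exists>d' \<delta>'. unstable_seg ((M ^^ n) q) d' \<delta>' \<and> (M ^^ n) q \<in> C"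
proof (induction n)
  case 0
  show ?case using assms by (simp del: split_paired_Ex) blast
next
  case (Suc n)
  then obtain d' \<delta>' where "unstable_seg ((M ^^ n) q) d' \<delta>'" "(M ^^ n) q \<in> C" by blast
  then show ?case using C_unst_step by (simp del: split_paired_Ex)
qed

lemma ltm_C: "M ` C = C"
proof -
  \<comment> \<open>An arbitrary direction: only the step of the base point, at parameter 0, is read
    off.\<close>
  have nz: "(1, 1) \<noteq> (0 :: real \<times> real)" by (simp add: zero_prod_def)
  have sub: "M ` C \<subseteq> C"
  proof (rule image_subsetI)
    fix q assume q: "q \<in> C"
    obtain q' d' \<epsilon> where "q' \<in> C" "0 < \<epsilon>" "mstep \<epsilon> (q, (1, 1)) (q', d')"
      using C_step[OF q nz] by blast
    then have "M (seg q (1, 1) 0) = seg q' d' 0" by auto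
    then show "M q \<in> C" using q \<open>q' \<in> C\<close> by (simp add: seg_C_0)
  qed
  have "finite C" by (simp add: C_def)
  then show ?thesis
    by (rule endo_inj_surj[OF _ sub inj_on_subset[OF inj_ltm C_R]])
qed

text \<open>Modulo 1 a half-integer shift of the core line gives the middle of the strip or the
  middle of the gap.\<close>

lemma frac_half_int:
  fixes y :: real
  assumes "frac (\<beta> / 2 + of_int j / 2) = y"
  shows "y \<noteq> 0" "y \<noteq> \<beta>"
proof -
  have "y = \<beta> / 2 \<or> y = (1 + \<beta>) / 2"
  proof (cases "even j")
    case True
    then obtain i where "j = 2 * i" by blast
    then have "frac (\<beta> / 2 + of_int j / 2) = frac (\<beta> / 2)" by (intro frac_eqI[where n = i]) simp
    then show ?thesis using assms \<beta> by simp
  next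
    case False
    then obtain i where "j = 2 * i + 1" by (elim oddE)
    then have "frac (\<beta> / 2 + of_int j / 2) = frac ((1 + \<beta>) / 2)"
      by (intro frac_eqI[where n = i]) (simp add: field_simps)
    then show ?thesis using assms \<beta> by simp
  qed
  then show "y \<noteq> 0" "y \<noteq> \<beta>" using \<beta> by auto
qed

lemma C_nonsingular: "C \<inter> singular_set \<alpha> \<beta> \<kappa> lam = {}"
proof (rule not_in_singular_set[OF C_R ltm_C])
  have "po \<notin> ltm_boundary \<alpha> \<beta> \<kappa>"
  proof (rule not_in_boundary)
    have "snd po + \<kappa> * fst po = \<beta> / 2 + of_int k / 2" using k by (simp add: po_def)
    then show "frac (snd po + \<kappa> * fst po) \<notin> {0, \<beta>}"
      using frac_half_int[of k, OF refl] by simp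
  qed (use \<alpha> \<beta> in \<open>auto simp: po_def\<close>)
  moreover have "pv \<notin> ltm_boundary \<alpha> \<beta> \<kappa>"
  proof (rule not_in_boundary)
    have "snd pv + \<kappa> * fst pv = \<beta> / 2 + of_int (k + 1) / 2"
      using k by (simp add: pv_def field_simps)
    then show "frac (snd pv + \<kappa> * fst pv) \<notin> {0, \<beta>}"
      using frac_half_int[of "k + 1", OF refl] by simp
  qed (use \<alpha> \<beta> in \<open>auto simp: pv_def\<close>)
  moreover have "ph \<notin> ltm_boundary \<alpha> \<beta> \<kappa>"
    by (rule not_in_boundary) (use \<alpha> \<beta> in \<open>auto simp: ph_def\<close>)
  ultimately show "C \<inter> ltm_boundary \<alpha> \<beta> \<kappa> = {}"
    by (auto simp: C_def pre_def post_def)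
qed

end

subsection \<open>Kinks from crossing the edge of a strip\<close>

lemma square_pos: "x \<noteq> 0 \<Longrightarrow> 0 < x * x" for x :: real
  using not_real_square_gt_zero by blast

lemma eventually_perturb:
  fixes a c b :: real
  shows "a < b \<Longrightarrow> \<forall>\<^sub>F \<tau> in nhds 0. a + \<tau> * c < b" "b < a \<Longrightarrow> \<forall>\<^sub>F \<tau> in nhds 0. b < a + \<tau> * c"
proof -
  have "((\<lambda>\<tau>. a + \<tau> * c) \<longlongrightarrow> a + 0 * c) (nhds 0)"
    by (intro tendsto_intros filterlim_ident)
  then show "a < b \<Longrightarrow> \<forall>\<^sub>F \<tau> in nhds 0. a + \<tau> * c < b" "b < a \<Longrightarrow> \<forall>\<^sub>F \<tau> in nhds 0. b < a + \<tau> * c"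
    by (auto dest: order_tendstoD)
qed

lemma eventually_nhds_0D:
  assumes "\<forall>\<^sub>F \<tau> in nhds (0::real). P \<tau>"
  shows "\<exists>\<epsilon>>0. \<forall>\<tau>. \<bar>\<tau>\<bar> \<le> \<epsilon> \<longrightarrow> P \<tau>"
  using assms by (simp add: eventually_nhds_metric_le)

context twist
begin

lemma \<kappa>_nonzero: "\<kappa> \<noteq> 0"
  using hyp by auto

lemma kinkI_C:
  assumes u: "unstable_seg q d \<delta>" "q \<in> C" and "0 < \<epsilon>" and
      "\<And>\<tau>. 0 \<le> \<tau> \<Longrightarrow> \<tau> \<le> \<epsilon> \<Longrightarrow> \<bar>t0 + \<tau> * \<rho>\<bar> < \<delta> \<and> (M ^^ n) (seg q d (t0 + \<tau> * \<rho>)) = seg p v \<tau>"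
      "\<And>\<tau>. 0 \<le> \<tau> \<Longrightarrow> \<tau> \<le> \<epsilon> \<Longrightarrow> \<bar>t0 - \<tau> * \<rho>\<bar> < \<delta> \<and> (M ^^ n) (seg q d (t0 - \<tau> * \<rho>)) = seg p w \<tau>"
    and "v \<bullet> w > 0" "fst v * snd w - snd v * fst w \<noteq> 0"
  shows "unstable_manifold_has_kinks \<alpha> \<beta> \<kappa> lam"
proof -
  obtain d' \<delta>' where *: "unstable_seg ((M ^^ n) q) d' \<delta>'" "(M ^^ n) q \<in> C"
    using C_unst_pow[OF u] by blast
  show ?thesis
  proof (rule kinkI[OF u(1) _ *(1)])
    show "(M ^^ n) (seg q d 0) \<notin> singular_set \<alpha> \<beta> \<kappa> lam"
      using C_nonsingular * u(2) by (auto simp: seg_C_0)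
    show "seg ((M ^^ n) q) d' 0 = (M ^^ n) (seg q d 0)"
      using * u(2) by (simp add: seg_C_0)
  qed (use assms in blast)+
qed

text \<open>Right of the edge \<open>f\<close> is idle, left of it \<open>f\<close> acts as V; since
  0 < \<open>y\<close> < \<beta>, both branches then undergo H. For slopes in the given cone the two
  resulting vectors agree in the sign of both components.\<close>

lemma kink_crossing_f:
  assumes u: "unstable_seg q (u, v) \<delta>" "q \<in> C" and t0: "\<bar>t0\<bar> < \<delta>" "q + t0 *\<^sub>R (u, v) = (\<alpha>, y)"
    and y: "0 < y" "y < \<beta>" and "u \<noteq> 0" and cone: "- (1/2) < v / (\<kappa> * u)" "v / (\<kappa> * u) < 0"
  shows "unstable_manifold_has_kinks \<alpha> \<beta> \<kappa> lam"
proof -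
  \<comment> \<open>In units of \<kappa>, V adds 1 to the slope. Below, \<tau> is the horizontal
    distance to the edge, whence the factor \<open>1 / u\<close>.\<close>
  define \<sigma> where "\<sigma> = v / (\<kappa> * u)"
  define c where "c = \<kappa> * lam"
  have v: "v = \<kappa> * \<sigma> * u" using \<open>u \<noteq> 0\<close> \<kappa>_nonzero by (simp add: \<sigma>_def)
  have seg: "seg q (u, v) (t0 + \<tau> * (1 / u)) = torus_proj (\<alpha> + \<tau>, y + \<tau> * (\<kappa> * \<sigma>))" for \<tau>
  proof -
    have "q + (t0 + \<tau> * (1 / u)) *\<^sub>R (u, v) = (q + t0 *\<^sub>R (u, v)) + (\<tau>, \<tau> * (\<kappa> * \<sigma>))"
      using \<open>u \<noteq> 0\<close> by (simp add: prod_eq_iff v field_simps)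
    then show ?thesis unfolding t0(2) by (simp add: seg_def)
  qed
  have "\<forall>\<^sub>F \<tau> in nhds 0. (- \<delta> < t0 + \<tau> * (1 / u) \<and> t0 + \<tau> * (1 / u) < \<delta>)
      \<and> (- \<delta> < t0 + \<tau> * (- 1 / u) \<and> t0 + \<tau> * (- 1 / u) < \<delta>)
      \<and> (0 < \<alpha> + \<tau> * 1 \<and> \<alpha> + \<tau> * 1 < 1) \<and> (0 < \<alpha> + \<tau> * - 1 \<and> \<alpha> + \<tau> * - 1 < 1)
      \<and> (0 < y + \<tau> * (\<kappa> * \<sigma>) \<and> y + \<tau> * (\<kappa> * \<sigma>) < \<beta>)
      \<and> (0 < y + \<tau> * (- (\<kappa> * (\<sigma> + 1))) \<and> y + \<tau> * (- (\<kappa> * (\<sigma> + 1))) < \<beta>)"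
    by (intro eventually_conj eventually_perturb) (use t0(1) y \<alpha> in simp_all)
  from eventually_nhds_0D[OF this] obtain \<epsilon> where \<epsilon>: "0 < \<epsilon>" and bounds: "\<forall>\<tau>. \<bar>\<tau>\<bar> \<le> \<epsilon> \<longrightarrow>
      (- \<delta> < t0 + \<tau> * (1 / u) \<and> t0 + \<tau> * (1 / u) < \<delta>)
      \<and> (- \<delta> < t0 + \<tau> * (- 1 / u) \<and> t0 + \<tau> * (- 1 / u) < \<delta>)
      \<and> (0 < \<alpha> + \<tau> * 1 \<and> \<alpha> + \<tau> * 1 < 1) \<and> (0 < \<alpha> + \<tau> * - 1 \<and> \<alpha> + \<tau> * - 1 < 1)
      \<and> (0 < y + \<tau> * (\<kappa> * \<sigma>) \<and> y + \<tau> * (\<kappa> * \<sigma>) < \<beta>)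
      \<and> (0 < y + \<tau> * (- (\<kappa> * (\<sigma> + 1))) \<and> y + \<tau> * (- (\<kappa> * (\<sigma> + 1))) < \<beta>)"
    by (elim exE conjE)
  have small: "\<bar>t0 + \<tau> * (1 / u)\<bar> < \<delta>" "\<bar>t0 - \<tau> * (1 / u)\<bar> < \<delta>" "\<alpha> + \<tau> < 1" "0 < \<alpha> - \<tau>"
      "0 < y + \<tau> * (\<kappa> * \<sigma>)" "y + \<tau> * (\<kappa> * \<sigma>) < \<beta>"
      "0 < y - \<tau> * (\<kappa> * (\<sigma> + 1))" "y - \<tau> * (\<kappa> * (\<sigma> + 1)) < \<beta>"
    if "0 \<le> \<tau>" "\<tau> \<le> \<epsilon>" for \<tau>
    using bounds[rule_format, of \<tau>] that by (simp_all add: abs_less_iff)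
  have outer: "M (seg q (u, v) (t0 + \<tau> * (1 / u))) = seg (\<alpha> + lam * y, y) (1 + c * \<sigma>, \<kappa> * \<sigma>) \<tau>"
    if "0 \<le> \<tau>" "\<tau> \<le> \<epsilon>" for \<tau>
  proof -
    note s = small[OF that]
    have "torus_proj (\<alpha> + \<tau>, y + \<tau> * (\<kappa> * \<sigma>)) \<in> R"
      using s by (intro torus_proj_strip_R(2)) auto
    moreover have "f (torus_proj (\<alpha> + \<tau>, y + \<tau> * (\<kappa> * \<sigma>))) = torus_proj (\<alpha> + \<tau>, y + \<tau> * (\<kappa> * \<sigma>))"
      using s that by (intro f_outside[of 0]) auto
    moreover have "g (torus_proj (\<alpha> + \<tau>, y + \<tau> * (\<kappa> * \<sigma>))) =
        torus_proj (\<alpha> + \<tau> + lam * (y + \<tau> * (\<kappa> * \<sigma>) - of_int 0), y + \<tau> * (\<kappa> * \<sigma>))"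
      using s by (intro g_strip) auto
    ultimately show ?thesis unfolding seg by (simp add: ltm_eq seg_pair c_def algebra_simps)
  qed
  have inner: "M (seg q (u, v) (t0 - \<tau> * (1 / u))) =
      seg (\<alpha> + lam * y, y) (- (1 + c * (\<sigma> + 1)), - (\<kappa> * (\<sigma> + 1))) \<tau>"
    if "0 \<le> \<tau>" "\<tau> \<le> \<epsilon>" for \<tau>
  proof -
    note s = small[OF that]
    have seg': "seg q (u, v) (t0 - \<tau> * (1 / u)) = torus_proj (\<alpha> - \<tau>, y - \<tau> * (\<kappa> * \<sigma>))"
      using seg[of "- \<tau>"] by simp
    have "torus_proj (\<alpha> - \<tau>, y - \<tau> * (\<kappa> * \<sigma>)) \<in> R"
      using s that by (intro torus_proj_strip_R(1)) auto
    moreover have "f (torus_proj (\<alpha> - \<tau>, y - \<tau> * (\<kappa> * \<sigma>))) =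
        torus_proj (\<alpha> - \<tau>, y - \<tau> * (\<kappa> * \<sigma>) + \<kappa> * (\<alpha> - \<tau> - of_int 0))"
      using s that by (intro f_strip) auto
    moreover have "\<dots> = torus_proj (\<alpha> - \<tau>, y - \<tau> * (\<kappa> * (\<sigma> + 1)))"
      using k by (intro torus_proj_eqI[where m = 0 and n = k]) (auto simp: algebra_simps)
    moreover have "g \<dots> = torus_proj (\<alpha> - \<tau> + lam * (y - \<tau> * (\<kappa> * (\<sigma> + 1)) - of_int 0), y - \<tau> * (\<kappa> * (\<sigma> + 1)))"
      using s by (intro g_strip) auto
    ultimately show ?thesis unfolding seg' by (simp add: ltm_eq seg_pair c_def algebra_simps)
  qed
  have \<sigma>: "- (1/2) < \<sigma>" "\<sigma> < 0" "c < -4" using cone hyp by (auto simp: \<sigma>_def c_def)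
  then have "0 < c * \<sigma>" by (simp add: mult_neg_neg)
  \<comment> \<open>The hyperbolicity bound and \<sigma> > -1/2 combine here: the first component of
    the inner branch exceeds 1.\<close>
  have "4 * (\<sigma> + 1) \<le> - c * (\<sigma> + 1)" using \<sigma> by (intro mult_right_mono) auto
  then have "c * (\<sigma> + 1) < -2" using \<sigma> by simp
  then have "0 < (1 + c * \<sigma>) * (- (1 + c * (\<sigma> + 1)))"
    using \<open>0 < c * \<sigma>\<close> by (intro mult_pos_pos) auto
  moreover have "0 < (\<kappa> * \<kappa>) * (- \<sigma> * (\<sigma> + 1))"
    using \<sigma> \<kappa>_nonzero by (intro mult_pos_pos[of "\<kappa> * \<kappa>"] mult_pos_pos[of "- \<sigma>"] square_pos) auto
  ultimately have dot: "(1 + c * \<sigma>, \<kappa> * \<sigma>) \<bullet> (- (1 + c * (\<sigma> + 1)), - (\<kappa> * (\<sigma> + 1))) > 0"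
    by (simp add: algebra_simps)
  \<comment> \<open>H preserves determinants, so this is the determinant of the two branches before
    \<open>g\<close>.\<close>
  have cross: "(1 + c * \<sigma>) * (- (\<kappa> * (\<sigma> + 1))) - \<kappa> * \<sigma> * (- (1 + c * (\<sigma> + 1))) = - \<kappa>"
    by (simp add: algebra_simps)
  show ?thesis
  proof (rule kinkI_C[OF u \<epsilon>, where n = 1])
    show "\<bar>t0 + \<tau> * (1 / u)\<bar> < \<delta> \<and> (M ^^ 1) (seg q (u, v) (t0 + \<tau> * (1 / u))) =
        seg (\<alpha> + lam * y, y) (1 + c * \<sigma>, \<kappa> * \<sigma>) \<tau>" if "0 \<le> \<tau>" "\<tau> \<le> \<epsilon>" for \<tau>
      using small outer that by simp
    show "\<bar>t0 - \<tau> * (1 / u)\<bar> < \<delta> \<and> (M ^^ 1) (seg q (u, v) (t0 - \<tau> * (1 / u))) =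
        seg (\<alpha> + lam * y, y) (- (1 + c * (\<sigma> + 1)), - (\<kappa> * (\<sigma> + 1))) \<tau>" if "0 \<le> \<tau>" "\<tau> \<le> \<epsilon>" for \<tau>
      using small inner that by simp
    show "fst (1 + c * \<sigma>, \<kappa> * \<sigma>) * snd (- (1 + c * (\<sigma> + 1)), - (\<kappa> * (\<sigma> + 1)))
        - snd (1 + c * \<sigma>, \<kappa> * \<sigma>) * fst (- (1 + c * (\<sigma> + 1)), - (\<kappa> * (\<sigma> + 1))) \<noteq> 0"
      using cross \<kappa>_nonzero by simp
  qed (rule dot)
qed

text \<open>After \<open>f\<close> the segment meets the edge at height \<beta>, where
  \<open>g\<close> bends it: the part above keeps its direction, the part below undergoes H. The
  vertex still lies over the interior of the vertical strip, so the next \<open>f\<close> acts as V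
  on both branches and turns both upwards.\<close>

lemma kink_crossing_g:
  assumes u: "unstable_seg q (u, v) \<delta>" "q \<in> C" and t0: "\<bar>t0\<bar> < \<delta>" "q + t0 *\<^sub>R (u, v) = (x, y)"
    and x: "0 < x" "x < \<alpha>" and y: "y + \<kappa> * x = \<beta> + of_int j"
    and "u \<noteq> 0" and cone: "1/2 < (v + \<kappa> * u) / (\<kappa> * u)"
  shows "unstable_manifold_has_kinks \<alpha> \<beta> \<kappa> lam"
proof -
  define \<sigma> where "\<sigma> = (v + \<kappa> * u) / (\<kappa> * u)"
  define c where "c = \<kappa> * lam"
  define i where "i = 1 / \<kappa>"
  define y2 where "y2 = \<beta> + \<kappa> * x"
  define m where "m = \<lfloor>y2\<rfloor>"
  \<comment> \<open>This makes the velocity after \<open>f\<close> equal to (1 / \<kappa>,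
    \<sigma>), so that positive \<tau> is the side above the edge whatever the signs of \<kappa> and
    \<open>u\<close>.\<close>
  define \<rho> where "\<rho> = 1 / (\<kappa> * u)"
  define a2 where "a2 = - (i + lam * \<sigma>)"
  define s2 where "s2 = - (\<sigma> + 1 + c * \<sigma>)"
  have i: "\<kappa> * i = 1" "i \<noteq> 0" using \<kappa>_nonzero by (simp_all add: i_def)
  have \<kappa>i: "\<kappa> * (\<tau> * i) = \<tau>" for \<tau> using i by (metis mult.left_commute mult.right_neutral)
  then have \<kappa>_shift: "\<kappa> * (x + \<tau> * i) = \<kappa> * x + \<tau>" for \<tau> by (simp only: distrib_left)
  have lam: "lam = c * i" using i by (simp add: c_def)
  have v: "v = \<kappa> * (\<sigma> - 1) * u" using \<open>u \<noteq> 0\<close> \<kappa>_nonzero by (simp add: \<sigma>_def field_simps)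
  have \<sigma>: "1/2 < \<sigma>" "c < -4" using cone hyp by (auto simp: \<sigma>_def c_def)
  have c\<sigma>: "c * \<sigma> < - 4 * \<sigma>" using \<sigma> by (intro mult_strict_right_mono) auto
  have s2: "0 < s2" using c\<sigma> \<sigma> by (simp add: s2_def)
  have seg: "seg q (u, v) (t0 + \<tau> * \<rho>) = torus_proj (x + \<tau> * i, y + \<tau> * (\<sigma> - 1))" for \<tau>
  proof -
    have "q + (t0 + \<tau> * \<rho>) *\<^sub>R (u, v) = (q + t0 *\<^sub>R (u, v)) + (\<tau> * i, \<tau> * (\<sigma> - 1))"
      using \<open>u \<noteq> 0\<close> \<kappa>_nonzero by (simp add: prod_eq_iff v \<rho>_def i_def field_simps)
    then show ?thesis unfolding t0(2) by (simp add: seg_def)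
  qed
  have m: "of_int m \<le> y2" "y2 < of_int m + 1" by (simp_all add: m_def)
  \<comment> \<open>Both branches rise from the height \<open>y2\<close>, and \<open>h\<close> is
    the next height where \<open>g\<close> changes its formula. The edge of height \<beta> itself
    counts with the gap above it, so no position of \<open>y2\<close> is exceptional.\<close>
  define h where "h = (if y2 < of_int m + \<beta> then of_int m + \<beta> else of_int m + 1)"
  have h: "y2 < h" using m(2) unfolding h_def by simp
  have "\<forall>\<^sub>F \<tau> in nhds 0. (- \<delta> < t0 + \<tau> * \<rho> \<and> t0 + \<tau> * \<rho> < \<delta>)
      \<and> (- \<delta> < t0 + \<tau> * - \<rho> \<and> t0 + \<tau> * - \<rho> < \<delta>)
      \<and> (0 < x + \<tau> * i \<and> x + \<tau> * i < \<alpha>) \<and> (0 < x + \<tau> * - i \<and> x + \<tau> * - i < \<alpha>)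
      \<and> (0 < x + \<tau> * a2 \<and> x + \<tau> * a2 < \<alpha>)
      \<and> (0 < \<beta> + \<tau> * \<sigma> \<and> \<beta> + \<tau> * \<sigma> < 1) \<and> (0 < \<beta> + \<tau> * - \<sigma> \<and> \<beta> + \<tau> * - \<sigma> < 1)
      \<and> (y2 - 1 < y2 + \<tau> * (\<sigma> + 1) \<and> y2 + \<tau> * (\<sigma> + 1) < h)
      \<and> (y2 - 1 < y2 + \<tau> * s2 \<and> y2 + \<tau> * s2 < h)"
    by (intro eventually_conj eventually_perturb) (use t0(1) x h \<beta> in simp_all)
  from eventually_nhds_0D[OF this] obtain \<epsilon> where \<epsilon>: "0 < \<epsilon>" and bounds: "\<forall>\<tau>. \<bar>\<tau>\<bar> \<le> \<epsilon> \<longrightarrow> (- \<delta> < t0 + \<tau> * \<rho> \<and> t0 + \<tau> * \<rho> < \<delta>)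
      \<and> (- \<delta> < t0 + \<tau> * - \<rho> \<and> t0 + \<tau> * - \<rho> < \<delta>)
      \<and> (0 < x + \<tau> * i \<and> x + \<tau> * i < \<alpha>) \<and> (0 < x + \<tau> * - i \<and> x + \<tau> * - i < \<alpha>)
      \<and> (0 < x + \<tau> * a2 \<and> x + \<tau> * a2 < \<alpha>)
      \<and> (0 < \<beta> + \<tau> * \<sigma> \<and> \<beta> + \<tau> * \<sigma> < 1) \<and> (0 < \<beta> + \<tau> * - \<sigma> \<and> \<beta> + \<tau> * - \<sigma> < 1)
      \<and> (y2 - 1 < y2 + \<tau> * (\<sigma> + 1) \<and> y2 + \<tau> * (\<sigma> + 1) < h)
      \<and> (y2 - 1 < y2 + \<tau> * s2 \<and> y2 + \<tau> * s2 < h)"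
    by (elim exE conjE)
  have small: "\<bar>t0 + \<tau> * \<rho>\<bar> < \<delta>" "\<bar>t0 - \<tau> * \<rho>\<bar> < \<delta>" "0 < x + \<tau> * i" "x + \<tau> * i < \<alpha>"
      "0 < x - \<tau> * i" "x - \<tau> * i < \<alpha>" "0 < x + \<tau> * a2" "x + \<tau> * a2 < \<alpha>"
      "\<beta> + \<tau> * \<sigma> < 1" "0 < \<beta> - \<tau> * \<sigma>" "y2 + \<tau> * (\<sigma> + 1) < h" "y2 + \<tau> * s2 < h"
    if "0 \<le> \<tau>" "\<tau> \<le> \<epsilon>" for \<tau>
    using bounds[rule_format, of \<tau>] that by (simp_all add: abs_less_iff)
  have pos: "0 \<le> \<tau> * \<sigma>" "0 \<le> \<tau> * (\<sigma> + 1)" "0 \<le> \<tau> * s2" if "0 \<le> \<tau>" for \<tau>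
    using that \<sigma> s2 by auto
  have first: "M (seg q (u, v) (t0 + \<tau> * \<rho>)) = g (torus_proj (x + \<tau> * i, \<beta> + \<tau> * \<sigma>))"
    if "0 < x + \<tau> * i" "x + \<tau> * i < \<alpha>" for \<tau>
  proof -
    have "torus_proj (x + \<tau> * i, y + \<tau> * (\<sigma> - 1)) \<in> R"
      using that by (intro torus_proj_strip_R(1)) auto
    moreover have "f (torus_proj (x + \<tau> * i, y + \<tau> * (\<sigma> - 1))) =
        torus_proj (x + \<tau> * i, y + \<tau> * (\<sigma> - 1) + \<kappa> * (x + \<tau> * i - of_int 0))"
      using that by (intro f_strip) auto
    moreover have "\<dots> = torus_proj (x + \<tau> * i, \<beta> + \<tau> * \<sigma>)"
    proof (rule torus_proj_eqI[where m = 0 and n = j])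
      show "y + \<tau> * (\<sigma> - 1) + \<kappa> * (x + \<tau> * i - of_int 0) - (\<beta> + \<tau> * \<sigma>) = of_int j"
        unfolding of_int_0 diff_0_right \<kappa>_shift using y by (simp add: algebra_simps)
    qed simp
    ultimately show ?thesis unfolding seg by (simp add: ltm_eq)
  qed
  have second: "M (torus_proj (x', y')) = g (torus_proj (x', y' + \<kappa> * x'))" if "0 < x'" "x' < \<alpha>" for x' y'
  proof -
    have "torus_proj (x', y') \<in> R" using that by (intro torus_proj_strip_R(1)) auto
    moreover have "f (torus_proj (x', y')) = torus_proj (x', y' + \<kappa> * (x' - of_int 0))"
      using that by (intro f_strip) auto
    ultimately show ?thesis by (simp add: ltm_eq)
  qed
  have outer: "(M ^^ 2) (seg q (u, v) (t0 + \<tau> * \<rho>)) = g (torus_proj (x + \<tau> * i, y2 + \<tau> * (\<sigma> + 1)))"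
    if "0 \<le> \<tau>" "\<tau> \<le> \<epsilon>" for \<tau>
  proof -
    note s = small[OF that] pos[OF that(1)]
    have "g (torus_proj (x + \<tau> * i, \<beta> + \<tau> * \<sigma>)) = torus_proj (x + \<tau> * i, \<beta> + \<tau> * \<sigma>)"
      using s by (intro g_outside[of 0]) auto
    moreover have "\<beta> + \<tau> * \<sigma> + \<kappa> * (x + \<tau> * i) = y2 + \<tau> * (\<sigma> + 1)"
      unfolding \<kappa>_shift by (simp add: y2_def algebra_simps)
    ultimately show ?thesis
      using first[of \<tau>] second[of "x + \<tau> * i" "\<beta> + \<tau> * \<sigma>"] s by (simp add: numeral_2_eq_2)
  qed
  have inner: "(M ^^ 2) (seg q (u, v) (t0 - \<tau> * \<rho>)) = g (torus_proj (x + \<tau> * a2, y2 + \<tau> * s2))"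
    if "0 \<le> \<tau>" "\<tau> \<le> \<epsilon>" for \<tau>
  proof -
    note s = small[OF that] pos[OF that(1)]
    have "g (torus_proj (x - \<tau> * i, \<beta> - \<tau> * \<sigma>)) =
        torus_proj (x - \<tau> * i + lam * (\<beta> - \<tau> * \<sigma> - of_int 0), \<beta> - \<tau> * \<sigma>)"
      using s by (intro g_strip) auto
    also have "\<dots> = torus_proj (x + \<tau> * a2, \<beta> - \<tau> * \<sigma>)"
      using l by (intro torus_proj_eqI[where m = l and n = 0]) (auto simp: a2_def algebra_simps)
    finally have *: "g (torus_proj (x - \<tau> * i, \<beta> - \<tau> * \<sigma>)) = torus_proj (x + \<tau> * a2, \<beta> - \<tau> * \<sigma>)" .
    have "\<kappa> * a2 = - (1 + c * \<sigma>)"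
      using i by (simp add: a2_def c_def algebra_simps)
    then have \<kappa>_shift2: "\<kappa> * (x + \<tau> * a2) = \<kappa> * x + \<tau> * - (1 + c * \<sigma>)"
      by (simp only: distrib_left mult.left_commute[of \<kappa>])
    have "\<beta> - \<tau> * \<sigma> + \<kappa> * (x + \<tau> * a2) = y2 + \<tau> * s2"
      unfolding \<kappa>_shift2 by (simp add: y2_def s2_def algebra_simps)
    then show ?thesis
      using first[of "- \<tau>"] second[of "x + \<tau> * a2" "\<beta> - \<tau> * \<sigma>"] s * by (simp add: numeral_2_eq_2)
  qed
  have a2: "a2 = - i * (1 + c * \<sigma>)" by (simp add: a2_def lam algebra_simps)
  \<comment> \<open>V has determinant 1, so this is the determinant of the bend made by the first
    \<open>g\<close>.\<close>
  have cross0: "i * s2 - (\<sigma> + 1) * a2 = i * c * \<sigma> * \<sigma>"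
    by (simp add: a2 s2_def algebra_simps)
  have nz: "i * c * \<sigma> * \<sigma> \<noteq> 0" using i \<sigma> by auto
  show ?thesis
  proof (cases "y2 < of_int m + \<beta>")
    case True
    then have h_eq: "h = of_int m + \<beta>" by (simp add: h_def)
    have inside: "g (torus_proj (x + \<tau> * a, y2 + \<tau> * s)) = seg (x + lam * (y2 - of_int m), y2) (a + lam * s, s) \<tau>"
      if "0 \<le> \<tau> * s" "y2 + \<tau> * s < h" for \<tau> a s
    proof -
      have "g (torus_proj (x + \<tau> * a, y2 + \<tau> * s)) =
          torus_proj (x + \<tau> * a + lam * (y2 + \<tau> * s - of_int m), y2 + \<tau> * s)"
        using that m h_eq by (intro g_strip) auto
      then show ?thesis by (simp add: seg_pair algebra_simps)
    qed
    let ?v = "(i + lam * (\<sigma> + 1), \<sigma> + 1)" and ?w = "(a2 + lam * s2, s2)"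
    have "1 + c * (\<sigma> + 1) < 0" using c\<sigma> \<sigma> by (simp add: algebra_simps)
    moreover have "- (1 + c * \<sigma>) + c * s2 < 0"
    proof -
      \<comment> \<open>The expression equals -1 - c - c (c + 2) \<sigma>. By \<sigma> > 1/2 it is
        below 1 - (c + 2)^2 / 2, which is negative for c < -4.\<close>
      have "(- 2 - c) * (2 * \<sigma> - 1) > 0" using \<sigma> by (intro mult_pos_pos) auto
      moreover have "c * (c + 2) * (2 * \<sigma> - 1) > 0"
        using \<sigma> by (intro mult_pos_pos mult_neg_neg) auto
      moreover have "2 * 2 < (- c - 2) * (- c - 2)"
        using \<sigma> by (intro mult_strict_mono) auto
      ultimately show ?thesis by (simp add: s2_def algebra_simps)
    qed
    ultimately have "0 < (1 + c * (\<sigma> + 1)) * (- (1 + c * \<sigma>) + c * s2)" by (intro mult_neg_neg)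
    then have "0 < (i * i) * ((1 + c * (\<sigma> + 1)) * (- (1 + c * \<sigma>) + c * s2))"
      using i by (intro mult_pos_pos[of "i * i"] square_pos) auto
    moreover have "0 < (\<sigma> + 1) * s2" using \<sigma> s2 by simp
    ultimately have dot: "?v \<bullet> ?w > 0" by (simp add: a2 lam algebra_simps)
    have cross: "fst ?v * snd ?w - snd ?v * fst ?w \<noteq> 0"
      using cross0 nz by (simp add: algebra_simps)
    show ?thesis
      by (rule kinkI_C[OF u \<epsilon>, where n = 2, OF _ _ dot cross])
        (use small outer inner inside pos in auto)
  next
    case False
    then have h_eq: "h = of_int m + 1" by (simp add: h_def)
    have outside: "g (torus_proj (x + \<tau> * a, y2 + \<tau> * s)) = seg (x, y2) (a, s) \<tau>"
      if "0 \<le> \<tau> * s" "y2 + \<tau> * s < h" for \<tau> a s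
      unfolding seg_pair using that False h_eq by (intro g_outside[of m]) auto
    let ?v = "(i, \<sigma> + 1)" and ?w = "(a2, s2)"
    have "0 < (i * i) * (- (1 + c * \<sigma>))"
      using i c\<sigma> \<sigma> by (intro mult_pos_pos[of "i * i"] square_pos) auto
    moreover have "0 < (\<sigma> + 1) * s2" using \<sigma> s2 by simp
    ultimately have dot: "?v \<bullet> ?w > 0" by (simp add: a2 algebra_simps)
    have cross: "fst ?v * snd ?w - snd ?v * fst ?w \<noteq> 0"
      using cross0 nz by simp
    show ?thesis
      by (rule kinkI_C[OF u \<epsilon>, where n = 2, OF _ _ dot cross])
        (use small outer inner outside pos in auto)
  qed
qed

end

subsection \<open>Growth along the periodic orbit\<close>

text \<open>This is the characteristic equation at -\<open>m\<close> of a matrix with determinant 1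
  and trace 2 - \<open>D\<close>.\<close>

lemma hyperbolic_root:
  fixes D :: real
  assumes "4 < D"
  obtains m where "1 < m" "(1 + m)\<^sup>2 = D * m"
proof -
  define r where "r = sqrt ((D - 2)\<^sup>2 - 4)"
  define m where "m = (D - 2 + r) / 2"
  have "4 \<le> (D - 2)\<^sup>2" using assms power_mono[of 2 "D - 2" 2] by simp
  then have r: "r\<^sup>2 = (D - 2)\<^sup>2 - 4" "0 \<le> r"
    by (simp_all add: r_def)
  then have "1 < m" using assms by (simp add: m_def)
  moreover have "(1 + m)\<^sup>2 = D * m"
    using r(1) by (simp add: m_def power2_eq_square field_simps)
  ultimately show thesis by (rule that)
qed

context twist
begin

text \<open>The multiplicities with which the two strips are visited during one period of \<open>po\<close>.\<close>

definition a where "a = (if even k then 1 else 2 :: real)"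
definition b where "b = (if even l then 1 else 2 :: real)"

text \<open>The last two equations say that (1, \<kappa> \<sigma>) is an eigenvector of
  \<open>H\<^sup>b V\<^sup>a\<close>, whose trace is 2 + a b \<kappa> \<lambda> < -2; hence the
  negative eigenvalue. The bounds on \<sigma> are those of \<open>kink_crossing_f\<close>.\<close>

lemma eigendirection:
  obtains \<mu> \<sigma> where "\<mu> < -1" "- (1/2) < \<sigma>" "\<sigma> < 0"
    "\<sigma> + a = \<mu> * \<sigma>" "1 + b * (\<kappa> * lam) * (\<sigma> + a) = \<mu>"
proof -
  define D where "D = - (a * b * (\<kappa> * lam))"
  have ab: "1 \<le> a" "1 \<le> b" "a = 1 \<or> a = 2" by (auto simp: a_def b_def)
  have D: "4 * a < D"
  proof -
    have "a * 4 \<le> (a * b) * 4" using ab by (intro mult_right_mono) auto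
    also have "\<dots> < (a * b) * (- (\<kappa> * lam))"
      using ab hyp by (intro mult_strict_left_mono) auto
    finally show ?thesis by (simp add: D_def)
  qed
  then obtain m where m: "1 < m" "(1 + m)\<^sup>2 = D * m"
    using ab hyperbolic_root[of D] by auto
  \<comment> \<open>Needed for \<sigma> > -1/2, where \<sigma> = -a / (1 + m). For a = 2 it amounts
    to m > 3, which follows from D > 8.\<close>
  have "2 * a < 1 + m"
  proof (cases "a = 1")
    case False
    then have "a = 2" using ab by simp
    have "8 * m < D * m" using D m \<open>a = 2\<close> by (intro mult_strict_right_mono) auto
    then have "m * 6 < m * m + 1" using m(2) unfolding power2_eq_square ring_distribs by linarith
    have "3 < m"
    proof (rule ccontr)
      assume "\<not> 3 < m"
      then have "m * m \<le> 3 * m" using m by (intro mult_right_mono) auto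
      then show False using \<open>m * 6 < m * m + 1\<close> m by linarith
    qed
    then show ?thesis using \<open>a = 2\<close> by simp
  qed (use m in simp)
  show thesis
  proof (rule that[of "- m" "- a / (1 + m)"])
    show "- m < -1" "- a / (1 + m) < 0" using m ab by auto
    show "- (1/2) < - a / (1 + m)" using m \<open>2 * a < 1 + m\<close> by (simp add: field_simps)
    show *: "- a / (1 + m) + a = - m * (- a / (1 + m))" using m by (simp add: field_simps)
    have "1 + b * (\<kappa> * lam) * (m * a / (1 + m)) = 1 - D * m / (1 + m)"
      by (simp add: D_def mult_ac)
    also have "\<dots> = - m"
      unfolding m(2)[symmetric] using m(1) by (simp add: power2_eq_square)
    finally show "1 + b * (\<kappa> * lam) * (- a / (1 + m) + a) = - m"
      unfolding * by simp
  qed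
qed

text \<open>Each of the at most three steps is affine on some interval; \<open>T\<close> is the
  smallest. The bound on \<open>v\<close> keeps the initial segment inside the horizontal strip and
  is the base case of the growth argument.\<close>

lemma cycle_chain:
  fixes u v :: real
  defines "w \<equiv> v + a * \<kappa> * u"
  shows "\<exists>T>0. \<bar>v\<bar> * T \<le> \<beta> / 2 \<and> (mstep T)\<^sup>+\<^sup>+ (po, (u, v)) (po, (u + b * lam * w, w))"
proof -
  define v1 where "v1 = (if even k then v else v + \<kappa> * u)"
  define u1 where "u1 = u + lam * w"
  have w: "w = v1 + \<kappa> * u" by (simp add: w_def v1_def a_def)
  have "\<exists>T>0. \<bar>v\<bar> * T \<le> \<beta> / 2 \<and> (mstep T)\<^sup>*\<^sup>* (po, (u, v)) (pre, (u, v1))"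
  proof (cases "even k")
    case True
    then show ?thesis using exists_small[of "\<beta> / 2" "\<beta> / 2" v 0] \<beta> by (auto simp: pre_def v1_def)
  next
    case False
    obtain T where T: "0 < T" "\<bar>v\<bar> * T \<le> \<beta> / 2" "\<bar>u\<bar> * T \<le> \<alpha> / 2" "\<bar>v + \<kappa> * u\<bar> * T \<le> (1 - \<beta>) / 2"
    proof -
      obtain T1 where T1: "0 < T1" "\<bar>v\<bar> * T1 \<le> \<beta> / 2" "\<bar>u\<bar> * T1 \<le> \<alpha> / 2"
        using exists_small[of "\<beta> / 2" "\<alpha> / 2"] \<alpha> \<beta> by auto
      obtain T2 where T2: "0 < T2" "\<bar>v + \<kappa> * u\<bar> * T2 \<le> (1 - \<beta>) / 2"
        using exists_small[of "(1 - \<beta>) / 2" "(1 - \<beta>) / 2" _ 0] \<beta> by auto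
      have le: "\<bar>x\<bar> * min T1 T2 \<le> \<bar>x\<bar> * T1" "\<bar>x\<bar> * min T1 T2 \<le> \<bar>x\<bar> * T2" for x :: real
        by (intro mult_left_mono; simp)+
      show thesis
        by (rule that[OF _ order_trans[OF le(1) T1(2)] order_trans[OF le(1) T1(3)]
            order_trans[OF le(2) T2(2)]]) (use T1 T2 in simp)
    qed
    then show ?thesis using mstep_po[OF False T(3,4)] False
      by (intro exI[of _ T]) (simp add: v1_def r_into_rtranclp)
  qed
  then obtain T1 where T1: "0 < T1" "\<bar>v\<bar> * T1 \<le> \<beta> / 2" "(mstep T1)\<^sup>*\<^sup>* (po, (u, v)) (pre, (u, v1))"
    by blast
  obtain T2 where T2: "0 < T2" "mstep T2 (pre, (u, v1)) (post, (u1, w))"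
    using exists_small[of "\<alpha> / 2" "\<beta> / 2" u w] \<alpha> \<beta> mstep_pre[of u _ v1] by (auto simp: u1_def w simp del: mstep.simps)
  have "\<exists>T>0. (mstep T)\<^sup>*\<^sup>* (post, (u1, w)) (po, (u + b * lam * w, w))"
  proof (cases "even l")
    case True
    then show ?thesis by (intro exI[of _ 1]) (simp add: post_def u1_def b_def)
  next
    case False
    obtain T where "0 < T" "\<bar>u1\<bar> * T \<le> (1 - \<alpha>) / 2" "\<bar>w\<bar> * T \<le> \<beta> / 2"
      using exists_small[of "(1 - \<alpha>) / 2" "\<beta> / 2"] \<alpha> \<beta> by auto
    moreover have "u1 + lam * w = u + b * lam * w" using False by (simp add: u1_def b_def)
    ultimately show ?thesis using mstep_post[OF False, of u1 T w]
      by (intro exI[of _ T]) (simp add: r_into_rtranclp)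
  qed
  then obtain T3 where T3: "0 < T3" "(mstep T3)\<^sup>*\<^sup>* (post, (u1, w)) (po, (u + b * lam * w, w))"
    by blast
  define T where "T = min T1 (min T2 T3)"
  have T: "0 < T" "T \<le> T1" "T \<le> T2" "T \<le> T3" using T1 T2 T3 by (auto simp: T_def)
  have le: "mstep S \<le> mstep T" if "T \<le> S" for S
    using mstep_mono[OF _ that] by blast
  have "(mstep T)\<^sup>*\<^sup>* (po, (u, v)) (pre, (u, v1))"
    using rtranclp_mono[OF le[OF T(2)]] T1(3) by blast
  moreover have "mstep T (pre, (u, v1)) (post, (u1, w))"
    using le[OF T(3)] T2(2) by blast
  moreover have "(mstep T)\<^sup>*\<^sup>* (post, (u1, w)) (po, (u + b * lam * w, w))"
    using rtranclp_mono[OF le[OF T(4)]] T3(2) by blast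
  ultimately have "(mstep T)\<^sup>+\<^sup>+ (po, (u, v)) (po, (u + b * lam * w, w))"
    by (meson rtranclp_into_tranclp1 tranclp_rtranclp_tranclp)
  moreover have "\<bar>v\<bar> * T \<le> \<bar>v\<bar> * T1" using T by (intro mult_left_mono) auto
  ultimately show ?thesis using T(1) T1(2) by (intro exI[of _ T]) auto
qed

text \<open>Without kinks an unstable segment through \<open>po\<close> never meets the edge of a strip, so it survives
  a whole period with its parameter interval unchanged.\<close>

lemma cycle_unst:
  fixes u v :: real
  defines "w \<equiv> v + a * \<kappa> * u"
  assumes nk: "\<not> unstable_manifold_has_kinks \<alpha> \<beta> \<kappa> lam"
    and un: "unstable_seg po (u, v) \<delta>" and v: "\<bar>v\<bar> * \<delta> \<le> \<beta> / 2"
    and u: "u \<noteq> 0" and cone: "- (1/2) < v / (\<kappa> * u)" "v / (\<kappa> * u) < 0"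
  shows "\<bar>u\<bar> * \<delta> \<le> \<alpha> / 2" "unstable_seg po (u + b * lam * w, w) \<delta>" "\<bar>w\<bar> * \<delta> \<le> \<beta> / 2"
proof -
  note \<delta> = unstable_segD(2)[OF un]
  have quot: "(x + \<kappa> * u) / (\<kappa> * u) = x / (\<kappa> * u) + 1" for x
    using u \<kappa>_nonzero by (simp add: add_divide_distrib)
  have C: "po \<in> C" "pre \<in> C" "post \<in> C" by (auto simp: C_def)
  have time: "\<bar>c / x\<bar> < \<delta>" "c / x * x = c" "x \<noteq> 0" if "\<bar>c\<bar> < \<bar>x\<bar> * \<delta>" for c x :: real
  proof -
    show "x \<noteq> 0" using that by auto
    then show "\<bar>c / x\<bar> < \<delta>" "c / x * x = c" using that by (simp_all add: abs_divide divide_less_eq mult.commute)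
  qed
  have inside: "\<bar>t * x\<bar> < c" if "\<bar>t\<bar> < \<delta>" "\<bar>x\<bar> * \<delta> \<le> c" "0 < c" for t x c :: real
  proof (cases "x = 0")
    case False
    then have "\<bar>t\<bar> * \<bar>x\<bar> < \<delta> * \<bar>x\<bar>" using that by (intro mult_strict_right_mono) auto
    then show ?thesis using that by (simp add: abs_mult mult.commute)
  qed (use that in simp)
  show u\<delta>: "\<bar>u\<bar> * \<delta> \<le> \<alpha> / 2"
  proof (rule ccontr)
    assume "\<not> \<bar>u\<bar> * \<delta> \<le> \<alpha> / 2"
    then have less: "\<bar>\<alpha> / 2\<bar> < \<bar>u\<bar> * \<delta>" using \<alpha> by simp
    \<comment> \<open>The sign of \<open>t\<close> follows that of \<open>u\<close>, so it is always
      the right edge that is met; the bound on \<open>v\<close> keeps the meeting point strictly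
      inside the horizontal strip.\<close>
    define t where "t = \<alpha> / 2 / u"
    note t = time[OF less, folded t_def]
    have "\<bar>t * v\<bar> < \<beta> / 2" using inside[OF t(1) v] \<beta> by simp
    then have y: "0 < \<beta> / 2 + t * v" "\<beta> / 2 + t * v < \<beta>"
      unfolding abs_less_iff by linarith+
    have "po + t *\<^sub>R (u, v) = (\<alpha>, \<beta> / 2 + t * v)"
      using t(2) by (simp add: po_def)
    then show False
      using nk kink_crossing_f[OF un C(1) t(1) _ y u cone] by blast
  qed
  define v1 where "v1 = (if even k then v else v + \<kappa> * u)"
  have w: "w = v1 + \<kappa> * u" by (simp add: w_def v1_def a_def)
  have un1: "unstable_seg pre (u, v1) \<delta>"
  proof (cases "even k")
    case True
    then show ?thesis using un by (simp add: pre_def v1_def)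
  next
    case False
    have "\<bar>v + \<kappa> * u\<bar> * \<delta> \<le> (1 - \<beta>) / 2"
    proof (rule ccontr)
      assume "\<not> \<bar>v + \<kappa> * u\<bar> * \<delta> \<le> (1 - \<beta>) / 2"
      then have less: "\<bar>- (1 - \<beta>) / 2\<bar> < \<bar>v + \<kappa> * u\<bar> * \<delta>" using \<beta> by simp
      \<comment> \<open>After \<open>f\<close> the centre is \<open>pv\<close>, at distance (1 -
        \<beta>) / 2 above the edge, so the segment is followed downwards.\<close>
      define t where "t = - (1 - \<beta>) / 2 / (v + \<kappa> * u)"
      note t = time[OF less, folded t_def]
      have "\<bar>t * u\<bar> < \<alpha> / 2" using inside[OF t(1) u\<delta>] \<alpha> by simp
      then have x: "0 < \<alpha> / 2 + t * u" "\<alpha> / 2 + t * u < \<alpha>" unfolding abs_less_iff by linarith+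
      obtain j where "k = 2 * j + 1" using False by (elim oddE)
      then have "\<kappa> * (\<alpha> / 2) = of_int j + 1 / 2" using k by simp
      then have "\<beta> / 2 + t * v + \<kappa> * (\<alpha> / 2 + t * u) = \<beta> + of_int j"
        using t(2) by (simp add: field_simps)
      moreover have "1/2 < (v + \<kappa> * u) / (\<kappa> * u)"
        using cone(1) quot[of v] by linarith
      moreover have "po + t *\<^sub>R (u, v) = (\<alpha> / 2 + t * u, \<beta> / 2 + t * v)"
        by (simp add: po_def)
      ultimately show False
        using nk kink_crossing_g[OF un C(1) t(1) _ x _ u] by blast
    qed
    from unstable_seg_push[OF un mstep_po[OF False u\<delta> this]] show ?thesis
      using u False by (simp add: v1_def zero_prod_def)
  qed
  have "- (1/2) < v1 / (\<kappa> * u)"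
  proof (cases "even k")
    case True
    then show ?thesis using cone(1) by (simp add: v1_def)
  next
    case False
    then have "v1 / (\<kappa> * u) = v / (\<kappa> * u) + 1" using quot[of v] by (simp add: v1_def)
    then show ?thesis using cone(1) by linarith
  qed
  then have cone1: "1/2 < (v1 + \<kappa> * u) / (\<kappa> * u)"
    using quot[of v1] by linarith
  show w\<delta>: "\<bar>w\<bar> * \<delta> \<le> \<beta> / 2"
  proof (rule ccontr)
    assume "\<not> \<bar>w\<bar> * \<delta> \<le> \<beta> / 2"
    then have less: "\<bar>\<beta> / 2\<bar> < \<bar>v1 + \<kappa> * u\<bar> * \<delta>" using \<beta> by (simp add: w)
    define t where "t = \<beta> / 2 / (v1 + \<kappa> * u)"
    note t = time[OF less, folded t_def]
    have "\<bar>t * u\<bar> < \<alpha> / 2" using inside[OF t(1) u\<delta>] \<alpha> by simp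
    then have x: "0 < \<alpha> / 2 + t * u" "\<alpha> / 2 + t * u < \<alpha>" unfolding abs_less_iff by linarith+
    have "\<exists>j. snd pre + \<kappa> * (\<alpha> / 2) = \<beta> / 2 + of_int j"
    proof (cases "even k")
      case True
      then obtain j where "k = 2 * j" by blast
      then have "\<kappa> * (\<alpha> / 2) = of_int j" using k by simp
      moreover have "snd pre = \<beta> / 2" using True by (simp add: pre_def po_def)
      ultimately show ?thesis by (intro exI[of _ j]) simp
    next
      case False
      then obtain j where "k = 2 * j + 1" by (elim oddE)
      then have "\<kappa> * (\<alpha> / 2) = of_int j + 1 / 2" using k by simp
      moreover have "snd pre = (1 + \<beta>) / 2" using False by (simp add: pre_def pv_def)
      ultimately show ?thesis by (intro exI[of _ "j + 1"]) (simp add: field_simps)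
    qed
    then obtain j where "snd pre + \<kappa> * (\<alpha> / 2) = \<beta> / 2 + of_int j" by blast
    then have "snd pre + t * v1 + \<kappa> * (\<alpha> / 2 + t * u) = \<beta> + of_int j"
      using t(2) by (simp add: field_simps)
    moreover have "pre + t *\<^sub>R (u, v1) = (\<alpha> / 2 + t * u, snd pre + t * v1)"
      by (simp add: pre_def po_def pv_def)
    ultimately show False
      using nk kink_crossing_g[OF un1 C(2) t(1) _ x _ u cone1] by blast
  qed
  define u1 where "u1 = u + lam * w"
  have "w \<noteq> 0"
  proof
    assume "w = 0"
    then show False using cone1 unfolding w[symmetric] by simp
  qed
  have un2: "unstable_seg post (u1, w) \<delta>"
    using unstable_seg_push[OF un1 mstep_pre[OF u\<delta>, of v1]] w\<delta> \<open>w \<noteq> 0\<close>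
    by (simp add: u1_def w zero_prod_def)
  show "unstable_seg po (u + b * lam * w, w) \<delta>"
  proof (cases "even l")
    case True
    then show ?thesis using un2 by (simp add: post_def u1_def b_def)
  next
    case False
    define \<sigma> where "\<sigma> = w / (\<kappa> * u)"
    have \<sigma>: "1/2 < \<sigma>" using cone1 by (simp add: \<sigma>_def w)
    have w': "w = \<kappa> * \<sigma> * u" using u \<kappa>_nonzero by (simp add: \<sigma>_def)
    have u1: "u1 = (1 + \<kappa> * lam * \<sigma>) * u" by (simp add: u1_def w' algebra_simps)
    \<comment> \<open>Gives 1 + \<kappa> \<lambda> \<sigma> < -2 \<sigma>, so that H maps the slope
      ratio \<sigma> > 1/2 into the interval from -1/2 to 0 that a crossing by \<open>f\<close>
      demands.\<close>
    have "(\<kappa> * lam + 2) * \<sigma> < (\<kappa> * lam + 2) * (1/2)"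
      using hyp \<sigma> by (intro mult_strict_left_mono_neg) auto
    then have *: "1 + \<kappa> * lam * \<sigma> < - 2 * \<sigma>" using hyp by (simp add: algebra_simps)
    then have neg: "1 + \<kappa> * lam * \<sigma> < 0" using \<sigma> by simp
    then have "u1 \<noteq> 0" using u1 u by simp
    have eq: "w / (\<kappa> * u1) = \<sigma> / (1 + \<kappa> * lam * \<sigma>)"
      using u \<kappa>_nonzero by (simp add: u1 w')
    have ratio: "- (1/2) < \<sigma> / D" "\<sigma> / D < 0" if "D < - 2 * \<sigma>" for D
      using that \<sigma> by (simp_all add: field_simps)
    note cone2 = ratio[OF *, folded eq]
    have "\<bar>u1\<bar> * \<delta> \<le> (1 - \<alpha>) / 2"
    proof (rule ccontr)
      assume "\<not> \<bar>u1\<bar> * \<delta> \<le> (1 - \<alpha>) / 2"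
      then have less: "\<bar>- (1 - \<alpha>) / 2\<bar> < \<bar>u1\<bar> * \<delta>" using \<alpha> by simp
      \<comment> \<open>The centre \<open>ph\<close> lies to the right of the edge, at distance (1 -
        \<alpha>) / 2.\<close>
      define t where "t = - (1 - \<alpha>) / 2 / u1"
      note t = time[OF less, folded t_def]
      have "\<bar>t * w\<bar> < \<beta> / 2" using inside[OF t(1) w\<delta>] \<beta> by simp
      then have y: "0 < \<beta> / 2 + t * w" "\<beta> / 2 + t * w < \<beta>"
        unfolding abs_less_iff by linarith+
      have "post + t *\<^sub>R (u1, w) = (\<alpha>, \<beta> / 2 + t * w)"
        using t(2) False by (simp add: post_def ph_def field_simps)
      then show False
        using nk kink_crossing_f[OF un2 C(3) t(1) _ y \<open>u1 \<noteq> 0\<close> cone2] by blast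
    qed
    from unstable_seg_push[OF un2 mstep_post[OF False this w\<delta>]] have "unstable_seg po (u1 + lam * w, w) \<delta>"
      using \<open>w \<noteq> 0\<close> by (simp add: zero_prod_def)
    moreover have "u1 + lam * w = u + b * lam * w" using False by (simp add: u1_def b_def)
    ultimately show ?thesis by simp
  qed
qed

text \<open>The parameter interval stays fixed while the direction is multiplied by \<mu> in every
  period. The vertical bound that \<open>cycle_unst\<close> needs is also the one it returns for the
  new direction, so it can be iterated.\<close>

lemma has_kinks: "unstable_manifold_has_kinks \<alpha> \<beta> \<kappa> lam"
proof (rule ccontr)
  assume nk: "\<not> unstable_manifold_has_kinks \<alpha> \<beta> \<kappa> lam"
  obtain \<mu> \<sigma> where \<mu>: "\<mu> < -1" and \<sigma>: "- (1/2) < \<sigma>" "\<sigma> < 0"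
    and eig: "\<sigma> + a = \<mu> * \<sigma>" "1 + b * (\<kappa> * lam) * (\<sigma> + a) = \<mu>"
    by (rule eigendirection)
  have step: "s * (\<kappa> * \<sigma>) + a * \<kappa> * s = \<mu> * s * (\<kappa> * \<sigma>)"
    "s + b * lam * (\<mu> * s * (\<kappa> * \<sigma>)) = \<mu> * s" for s
  proof -
    have "s * (\<kappa> * \<sigma>) + a * \<kappa> * s = s * \<kappa> * (\<sigma> + a)" by (simp add: algebra_simps)
    then show 1: "s * (\<kappa> * \<sigma>) + a * \<kappa> * s = \<mu> * s * (\<kappa> * \<sigma>)" by (simp add: eig(1))
    have "s + b * lam * (\<mu> * s * (\<kappa> * \<sigma>)) = s * (1 + b * (\<kappa> * lam) * (\<mu> * \<sigma>))"
      by (simp add: algebra_simps)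
    then show "s + b * lam * (\<mu> * s * (\<kappa> * \<sigma>)) = \<mu> * s"
      using eig by simp
  qed
  obtain T where T: "0 < T" "\<bar>\<kappa> * \<sigma>\<bar> * T \<le> \<beta> / 2"
    "(mstep T)\<^sup>+\<^sup>+ (po, (1, \<kappa> * \<sigma>)) (po, (\<mu>, \<mu> * (\<kappa> * \<sigma>)))"
    using cycle_chain[where u = 1 and v = "\<kappa> * \<sigma>"] step[of 1] by auto
  have un: "unstable_seg po (1, \<kappa> * \<sigma>) T"
    using T \<mu> by (intro unstable_seg_of_cycle[of T po _ \<mu>]) (simp_all add: zero_prod_def)
  have grow: "unstable_seg po (\<mu> ^ n, \<mu> ^ n * (\<kappa> * \<sigma>)) T \<and> \<bar>\<mu> ^ n * (\<kappa> * \<sigma>)\<bar> * T \<le> \<beta> / 2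
      \<and> \<bar>\<mu> ^ n\<bar> * T \<le> \<alpha> / 2" for n
  proof -
    have cone: "- (1/2) < s * (\<kappa> * \<sigma>) / (\<kappa> * s)" "s * (\<kappa> * \<sigma>) / (\<kappa> * s) < 0" if "s \<noteq> 0" for s
      using that \<sigma> \<kappa>_nonzero by simp_all
    have \<mu>n: "\<mu> ^ n \<noteq> 0" for n using \<mu> by simp
    have "unstable_seg po (\<mu> ^ n, \<mu> ^ n * (\<kappa> * \<sigma>)) T \<and> \<bar>\<mu> ^ n * (\<kappa> * \<sigma>)\<bar> * T \<le> \<beta> / 2" for n
    proof (induction n)
      case 0
      then show ?case using un T by simp
    next
      case (Suc n)
      then show ?case
        using cycle_unst(2,3)[where u = "\<mu> ^ n" and v = "\<mu> ^ n * (\<kappa> * \<sigma>)" and \<delta> = T,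
            OF nk _ _ \<mu>n cone[OF \<mu>n]]
        unfolding step power_Suc by simp
    qed
    then show ?thesis using cycle_unst(1)[where u = "\<mu> ^ n" and v = "\<mu> ^ n * (\<kappa> * \<sigma>)" and \<delta> = T, OF nk _ _ \<mu>n cone[OF \<mu>n]] by blast
  qed
  \<comment> \<open>Beyond this \<open>n\<close> the half-extent in \<open>x\<close> exceeds 1,
    against the bound \<alpha> / 2.\<close>
  obtain n where "1 / T < \<bar>\<mu>\<bar> ^ n" using real_arch_pow[of "\<bar>\<mu>\<bar>"] \<mu> by auto
  then have "1 < \<bar>\<mu> ^ n\<bar> * T" using T by (simp add: divide_less_eq power_abs)
  with grow[of n] \<alpha> show False by simp
qed

end

theorem theorem7:
  fixes \<alpha> \<beta> \<kappa> lam :: real and k l :: int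
  assumes "0 < \<alpha>" "\<alpha> < 1" "0 < \<beta>" "\<beta> < 1"
    and "k * l < 0"
    and "\<kappa> = of_int k * inverse \<alpha>" "lam = of_int l * inverse \<beta>"
    and "\<kappa> * lam < -4"
  shows "unstable_manifold_has_kinks \<alpha> \<beta> \<kappa> lam"
proof -
  interpret twist \<alpha> \<beta> \<kappa> lam k l
    using assms by unfold_locales auto
  show ?thesis by (rule has_kinks)
qed

end
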